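(* There is a constant $c>0$ and an infinite class of CNF formulas such that every formula in the class with $n$ variables has an equivalent decision-DNNF of size $O(n^5)$, while every (uniform) read-once branching program computing it has size $\Omega(n^{\log n/c})$.
   Context: Logarithms are base 2. A de Morgan circuit is a Boolean circuit over $\vee,\wedge,\neg$ where negations are applied only to input variables; inputs may be variables or constants. For a gate $x$, $VReach(x)$ is the set of variables whose input gates have a path to $x$. An $\wedge$-gate is decomposable if any two of its in-neighbours $y_1,y_2$ satisfy $VReach(y_1)\cap VReach(y_2)=\emptyset$. A DNNF is a de Morgan circuit all of whose $\wedge$-gates are decomposable. An $\vee$-gate is a decision gate if it has exactly two in-neighbours $y_1,y_2$, both $\wedge$-gates, and for some variable $v$, $v$ is an input of $y_1$ and $\neg v$ is an input of $y_2$. A decision-DNNF is a DNNF all of whose $\vee$-gates are decision gates. A (deterministic) read-once branching program (ROBP) is a DAG with one root and two sinks labelled true and false, every non-sink labelled by a variable and having two out-edges labelled true and false, with no variable labelling two nodes on a directed path; an assignment is accepted iff the path it determines from the root reaches the true sink. Viewing a true/false out-edge of a node labelled $v$ as labelled by the literal $v$ / $\neg v$, and deleting the false sink and all nodes from which the true sink is unreachable, yields a branching program with one root and one leaf; the ROBP is called uniform if in this program, for every node $a$, any two root-to-$a$ paths are labelled by literals of the same variable set and every root-leaf path is labelled by literals of all variables. Size is the number of nodes (gates). *)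

theory Defs
  imports Complex_Main
begin

section \<open>CNF formulas\<close>

datatype lit = Pos nat | Neg nat

fun lit_var :: "lit \<Rightarrow> nat" where
  "lit_var (Pos v) = v"
| "lit_var (Neg v) = v"

fun lit_true :: "(nat \<Rightarrow> bool) \<Rightarrow> lit \<Rightarrow> bool" where
  "lit_true \<alpha> (Pos v) \<longleftrightarrow> \<alpha> v"
| "lit_true \<alpha> (Neg v) \<longleftrightarrow> \<not> \<alpha> v"

type_synonym cnf = "lit set set"

definition is_cnf :: "cnf \<Rightarrow> bool" where
  "is_cnf F \<longleftrightarrow> finite F \<and> (\<forall>K\<in>F. finite K)"

definition cnf_vars :: "cnf \<Rightarrow> nat set" where
  "cnf_vars F = lit_var ` \<Union>F"

definition num_vars :: "cnf \<Rightarrow> nat" where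
  "num_vars F = card (cnf_vars F)"

definition cnf_sat :: "(nat \<Rightarrow> bool) \<Rightarrow> cnf \<Rightarrow> bool" where
  "cnf_sat \<alpha> F \<longleftrightarrow> (\<forall>K\<in>F. \<exists>l\<in>K. lit_true \<alpha> l)"

section \<open>De Morgan circuits and decision-DNNFs\<close>

datatype gate_kind = VarG nat | ConstG bool | NotG | AndG | OrG

text \<open>Gates are named by natural numbers, which loses no generality for finite circuits.
  A pair \<open>(h, g)\<close> of \<open>wires\<close> means that \<open>h\<close> is an in-neighbour of \<open>g\<close>; the fan-in
  of and-gates and or-gates is unbounded.\<close>

record circuit =
  gates :: "nat set"
  wires :: "(nat \<times> nat) set"
  gkind :: "nat \<Rightarrow> gate_kind"
  outgate :: nat

definition in_nbrs :: "circuit \<Rightarrow> nat \<Rightarrow> nat set" where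
  "in_nbrs C g = {h. (h, g) \<in> wires C}"

definition de_morgan_circuit :: "circuit \<Rightarrow> bool" where
  "de_morgan_circuit C \<longleftrightarrow>
     finite (gates C) \<and> wires C \<subseteq> gates C \<times> gates C \<and> acyclic (wires C) \<and>
     outgate C \<in> gates C \<and>
     (\<forall>g\<in>gates C. case gkind C g of
         VarG v \<Rightarrow> in_nbrs C g = {}
       | ConstG b \<Rightarrow> in_nbrs C g = {}
       | NotG \<Rightarrow> (\<exists>h v. in_nbrs C g = {h} \<and> gkind C h = VarG v)
       | AndG \<Rightarrow> in_nbrs C g \<noteq> {}
       | OrG \<Rightarrow> in_nbrs C g \<noteq> {})"

text \<open>The gates evaluating to true under \<open>\<alpha>\<close>. Negation occurs only directly above a
  variable, so the rules are monotone, and since a circuit is finite and acyclic the least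
  fixed point is the usual bottom-up evaluation.\<close>

inductive gate_true :: "circuit \<Rightarrow> (nat \<Rightarrow> bool) \<Rightarrow> nat \<Rightarrow> bool"
  for C :: circuit and \<alpha> :: "nat \<Rightarrow> bool" where
  var: "gkind C g = VarG v \<Longrightarrow> \<alpha> v \<Longrightarrow> gate_true C \<alpha> g"
| const: "gkind C g = ConstG True \<Longrightarrow> gate_true C \<alpha> g"
| neg: "gkind C g = NotG \<Longrightarrow> h \<in> in_nbrs C g \<Longrightarrow> gkind C h = VarG v \<Longrightarrow> \<not> \<alpha> v
    \<Longrightarrow> gate_true C \<alpha> g"
| conj: "gkind C g = AndG \<Longrightarrow> (\<And>h. h \<in> in_nbrs C g \<Longrightarrow> gate_true C \<alpha> h)
    \<Longrightarrow> gate_true C \<alpha> g"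
| disj: "gkind C g = OrG \<Longrightarrow> h \<in> in_nbrs C g \<Longrightarrow> gate_true C \<alpha> h \<Longrightarrow> gate_true C \<alpha> g"

definition circuit_sat :: "(nat \<Rightarrow> bool) \<Rightarrow> circuit \<Rightarrow> bool" where
  "circuit_sat \<alpha> C \<longleftrightarrow> gate_true C \<alpha> (outgate C)"

definition VReach :: "circuit \<Rightarrow> nat \<Rightarrow> nat set" where
  "VReach C x = {v. \<exists>g\<in>gates C. gkind C g = VarG v \<and> (g, x) \<in> (wires C)\<^sup>*}"

definition circuit_vars :: "circuit \<Rightarrow> nat set" where
  "circuit_vars C = {v. \<exists>g\<in>gates C. gkind C g = VarG v}"

definition circuit_size :: "circuit \<Rightarrow> nat" where
  "circuit_size C = card (gates C)"

definition decomposable :: "circuit \<Rightarrow> nat \<Rightarrow> bool" where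
  "decomposable C g \<longleftrightarrow>
     (\<forall>y1\<in>in_nbrs C g. \<forall>y2\<in>in_nbrs C g. y1 \<noteq> y2 \<longrightarrow> VReach C y1 \<inter> VReach C y2 = {})"

definition dnnf :: "circuit \<Rightarrow> bool" where
  "dnnf C \<longleftrightarrow> de_morgan_circuit C \<and>
     (\<forall>g\<in>gates C. gkind C g = AndG \<longrightarrow> decomposable C g)"

definition decision_gate :: "circuit \<Rightarrow> nat \<Rightarrow> bool" where
  "decision_gate C g \<longleftrightarrow>
     (\<exists>y1 y2 v. y1 \<noteq> y2 \<and> in_nbrs C g = {y1, y2} \<and>
        gkind C y1 = AndG \<and> gkind C y2 = AndG \<and>
        (\<exists>h\<in>in_nbrs C y1. gkind C h = VarG v) \<and>
        (\<exists>h\<in>in_nbrs C y2. gkind C h = NotG \<and> (\<exists>k\<in>in_nbrs C h. gkind C k = VarG v)))"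

definition decision_dnnf :: "circuit \<Rightarrow> bool" where
  "decision_dnnf C \<longleftrightarrow> dnnf C \<and>
     (\<forall>g\<in>gates C. gkind C g = OrG \<longrightarrow> decision_gate C g)"

definition circuit_equiv_cnf :: "circuit \<Rightarrow> cnf \<Rightarrow> bool" where
  "circuit_equiv_cnf C F \<longleftrightarrow>
     circuit_vars C \<subseteq> cnf_vars F \<and> (\<forall>\<alpha>. circuit_sat \<alpha> C \<longleftrightarrow> cnf_sat \<alpha> F)"

section \<open>Read-once branching programs\<close>

text \<open>\<open>bsucc B a b\<close> is the head of the out-edge of \<open>a\<close> labelled \<open>b\<close>; the values of \<open>blabel\<close>
  and \<open>bsucc\<close> are meaningful only at non-sinks.\<close>

record bprogram =
  bnodes :: "nat set"
  broot :: nat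
  true_sink :: nat
  false_sink :: nat
  blabel :: "nat \<Rightarrow> nat"
  bsucc :: "nat \<Rightarrow> bool \<Rightarrow> nat"

definition inner_nodes :: "bprogram \<Rightarrow> nat set" where
  "inner_nodes B = bnodes B - {true_sink B, false_sink B}"

definition bedges :: "bprogram \<Rightarrow> (nat \<times> nat) set" where
  "bedges B = {(a, bsucc B a b) | a b. a \<in> inner_nodes B}"

text \<open>The root is the only source among the non-sinks. A sink may be unreachable, or may itself
  be the root: in a read-once program every directed path is followed by some assignment, so
  otherwise constant functions would not be computed by any program, and lower bounds for
  unsatisfiable or valid formulas would hold vacuously.\<close>

definition robp :: "bprogram \<Rightarrow> bool" where
  "robp B \<longleftrightarrow>
     finite (bnodes B) \<and> bedges B \<subseteq> bnodes B \<times> bnodes B \<and> acyclic (bedges B) \<and>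
     true_sink B \<in> bnodes B \<and> false_sink B \<in> bnodes B \<and> true_sink B \<noteq> false_sink B \<and>
     broot B \<in> bnodes B \<and> broot B \<notin> Range (bedges B) \<and>
     (\<forall>a\<in>inner_nodes B. a \<notin> Range (bedges B) \<longrightarrow> a = broot B) \<and>
     (\<forall>a\<in>inner_nodes B. \<forall>a'\<in>inner_nodes B.
        (a, a') \<in> (bedges B)\<^sup>+ \<longrightarrow> blabel B a \<noteq> blabel B a')"

definition robp_accepts :: "bprogram \<Rightarrow> (nat \<Rightarrow> bool) \<Rightarrow> bool" where
  "robp_accepts B \<alpha> \<longleftrightarrow>
     (broot B, true_sink B) \<in> {(a, bsucc B a (\<alpha> (blabel B a))) | a. a \<in> inner_nodes B}\<^sup>*"

definition robp_computes :: "bprogram \<Rightarrow> cnf \<Rightarrow> bool" where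
  "robp_computes B F \<longleftrightarrow> (\<forall>\<alpha>. robp_accepts B \<alpha> \<longleftrightarrow> cnf_sat \<alpha> F)"

definition robp_size :: "bprogram \<Rightarrow> nat" where
  "robp_size B = card (bnodes B)"

text \<open>A formula class in the main statement is required to have unboundedly many variable
  numbers: being infinite as a set of formulas would be too weak, because renaming the variables
  of a single formula already yields infinitely many formulas and makes asymptotic bounds
  meaningless. The lower bound there ranges over all read-once branching programs, so it
  covers in particular the uniform ones.\<close>

end

theory Submission
  imports Defs "HOL-Library.Countable"
begin

text \<open>Each node of the ternary tree of height \<open>r\<close> carries a block of \<open>2 * r\<close> variables, and for
  vertices \<open>u\<close>, \<open>v\<close> in adjacent blocks there is a clause \<open>x\<^sub>u \<or> e\<^sub>u\<^sub>v \<or> x\<^sub>v\<close> with its own edge variable.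
  Branching on the block of a node, given the assignment of the parent block, makes the subtrees
  independent and yields a decision-DNNF of size \<open>2\<^bsup>O(r)\<^esup>\<close>.

  For the lower bound, consider the assignments that choose all \<open>x\<^sub>u\<close> freely and set \<open>e\<^sub>u\<^sub>v\<close> to
  \<open>\<not> x\<^sub>u \<and> \<not> x\<^sub>v\<close>. The variables, in the order in which they can no longer be
  queried along a run, have an initial segment \<open>S\<close> such that \<open>r\<^sup>2\<close> pairwise disjoint edges \<open>uv\<close>
  cross from \<open>S\<close> to its complement. If two of these assignments pass the corresponding place of
  the program, then the assignment agreeing with the first on \<open>S\<close> and with the second off \<open>S\<close> is
  accepted too; hence for each crossing edge one of the patterns \<open>(0, 1)\<close>, \<open>(1, 0)\<close>
  of \<open>(x\<^sub>u, x\<^sub>v)\<close> never occurs at this place. So a place serves at most the fraction \<open>(3/4)^(r^2)\<close> of the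
  assignments.\<close>

section \<open>Families avoiding a pattern on disjoint pairs\<close>

definition disjoint_pairs :: "('a \<times> 'a) set \<Rightarrow> bool" where
  "disjoint_pairs M \<longleftrightarrow>
     pairwise (\<lambda>e e'. {fst e, snd e} \<inter> {fst e', snd e'} = {}) M"

text \<open>A set \<open>X - {u, v}\<close> extends to at most three members of \<open>A\<close>: of
  the four traces on \<open>{u, v}\<close>, one containing exactly one of the two elements is
  excluded.\<close>

lemma card_le_forbidden_pattern:
  assumes "A \<subseteq> Pow V" "finite V"
    and "(\<forall>X\<in>A. v \<in> X \<longrightarrow> u \<in> X) \<or> (\<forall>X\<in>A. u \<in> X \<longrightarrow> v \<in> X)"
  shows "card A \<le> 3 * card ((\<lambda>X. X - {u, v}) ` A)"
proof -
  \<comment> \<open>Naming the pair so that \<open>y\<close> never occurs without \<open>x\<close>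
    treats both alternatives at once; the traces left are \<open>{}\<close>, \<open>{x}\<close> and
    \<open>{x, y}\<close>.\<close>
  obtain x y where xy: "{x, y} = {u, v}" "\<forall>X\<in>A. y \<in> X \<longrightarrow> x \<in> X"
    using assms(3) by (metis insert_commute)
  let ?f = "\<lambda>X. (X - {u, v}, X \<inter> {u, v})"
  have "inj_on ?f A" by (auto simp: inj_on_def)
  moreover have "?f ` A \<subseteq> (\<lambda>X. X - {u, v}) ` A \<times> {{}, {x}, {x, y}}"
    using xy by (auto simp flip: xy(1))
  moreover have finA: "finite A" using assms(1,2) by (meson finite_Pow_iff finite_subset)
  ultimately have "card A \<le> card ((\<lambda>X. X - {u, v}) ` A \<times> {{}, {x}, {x, y}})"
    by (intro card_inj_on_le[of ?f]) auto
  also have "\<dots> \<le> card ((\<lambda>X. X - {u, v}) ` A) * 3"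
    unfolding card_cartesian_product by (intro mult_left_mono) (auto simp: card_insert_if)
  finally show ?thesis by simp
qed

text \<open>Every pair costs a factor 3/4. Deleting one pair from all members shrinks the family by
  at most a factor 3, while the power set of \<open>V\<close> shrinks by a factor 4.\<close>

lemma card_family_disjoint_pairs:
  assumes "finite M" "finite V" "A \<subseteq> Pow V" "disjoint_pairs M"
    and "\<And>u v. (u, v) \<in> M \<Longrightarrow> u \<in> V \<and> v \<in> V \<and> u \<noteq> v"
    and "\<And>u v. (u, v) \<in> M \<Longrightarrow>
      (\<forall>X\<in>A. v \<in> X \<longrightarrow> u \<in> X) \<or> (\<forall>X\<in>A. u \<in> X \<longrightarrow> v \<in> X)"
  shows "card A * 4 ^ card M \<le> 3 ^ card M * 2 ^ card V"
  using assms
proof (induction M arbitrary: A V rule: finite_induct)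
  case empty
  then show ?case using card_mono[of "Pow V" A] by (simp add: card_Pow)
next
  case (insert e M)
  obtain u v where e: "e = (u, v)" by fastforce
  let ?A = "(\<lambda>X. X - {u, v}) ` A" and ?V = "V - {u, v}"
  have uv: "u \<in> V" "v \<in> V" "u \<noteq> v" using insert.prems(4) e by auto
  \<comment> \<open>The other pairs do not meet \<open>{u, v}\<close>, so their forbidden patterns
    survive the deletion.\<close>
  have disj: "u \<notin> {x, y} \<and> v \<notin> {x, y}" if "(x, y) \<in> M" for x y
  proof -
    have "(x, y) \<noteq> e" using insert.hyps(2) that by auto
    then have "{fst e, snd e} \<inter> {fst (x, y), snd (x, y)} = {}"
      using insert.prems(3) that unfolding disjoint_pairs_def pairwise_insert by blast
    then show ?thesis by (auto simp: e)
  qed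
  have "card ?A * 4 ^ card M \<le> 3 ^ card M * 2 ^ card ?V"
  proof (rule insert.IH)
    show "disjoint_pairs M" using insert.prems(3) by (simp add: disjoint_pairs_def pairwise_insert)
    show "x \<in> ?V \<and> y \<in> ?V \<and> x \<noteq> y" if "(x, y) \<in> M" for x y
      using disj[OF that] insert.prems(4) that by blast
    show "(\<forall>X\<in>?A. y \<in> X \<longrightarrow> x \<in> X) \<or> (\<forall>X\<in>?A. x \<in> X \<longrightarrow> y \<in> X)"
      if "(x, y) \<in> M" for x y
      using disj[OF that] insert.prems(5)[of x y] that by auto
  qed (use insert.prems in auto)
  then have IH: "3 * card ?A * 4 * 4 ^ card M \<le> 12 * (3 ^ card M * 2 ^ card ?V)" by simp
  have "card A \<le> 3 * card ?A"
    using insert.prems e by (intro card_le_forbidden_pattern[of A V]) auto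
  then have "card A * 4 * 4 ^ card M \<le> 3 * card ?A * 4 * 4 ^ card M" by simp
  also note IH
  also have "card V = Suc (Suc (card ?V))"
    using uv insert.prems(1) card_Suc_Diff1[of V u] card_Suc_Diff1[of "V - {u}" v]
    by (simp add: Diff_insert2[symmetric] insert_commute)
  then have "12 * (3 ^ card M * 2 ^ card ?V) = 3 ^ Suc (card M) * (2 ^ card V :: nat)" by simp
  finally show ?case using insert.hyps by simp
qed

section \<open>Cuts of the ternary tree\<close>

text \<open>A node of the tree is the list of child numbers on the way up to the root \<open>[]\<close>, so the
  parent of \<open>y\<close> is \<open>tl y\<close>.\<close>

definition subtree :: "nat list \<Rightarrow> nat \<Rightarrow> nat list set" where
  "subtree t d = {w @ t | w. set w \<subseteq> {..<3} \<and> length w \<le> d}"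

lemma subtree_child: "c < 3 \<Longrightarrow> subtree (c # t) d \<subseteq> subtree t (Suc d)"
proof
  fix y assume c: "c < 3" and "y \<in> subtree (c # t) d"
  then obtain w where w: "y = w @ c # t" "set w \<subseteq> {..<3}" "length w \<le> d" by (auto simp: subtree_def)
  then have "y = (w @ [c]) @ t" "set (w @ [c]) \<subseteq> {..<3}" "length (w @ [c]) \<le> Suc d" using c by auto
  then show "y \<in> subtree t (Suc d)" unfolding subtree_def by blast
qed

lemma subtree_children_disjoint: "c \<noteq> c' \<Longrightarrow> subtree (c # t) d \<inter> subtree (c' # t) d = {}"
  by (auto simp: subtree_def append_eq_append_conv2 append_eq_Cons_conv Cons_eq_append_conv)

text \<open>A discrete intermediate value theorem: if \<open>P\<close> differs at the two ends of a
  branch, it differs across one of its edges.\<close>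

lemma exists_change_on_branch:
  "P (w @ t) \<noteq> P t \<Longrightarrow> \<exists>w' c u. w = w' @ c # u \<and> P (c # u @ t) \<noteq> P (u @ t)"
proof (induction w)
  case (Cons c w)
  show ?case
  proof (cases "P (w @ t) = P t")
    case True
    then show ?thesis using Cons.prems by (intro exI[of _ "[]"] exI[of _ c] exI[of _ w]) auto
  next
    case False
    then obtain w' c' u where "w = w' @ c' # u" "P (c' # u @ t) \<noteq> P (u @ t)" using Cons.IH by blast
    then show ?thesis by (intro exI[of _ "c # w'"] exI[of _ c'] exI[of _ u]) auto
  qed
qed simp

lemma three_distinct_sorted:
  fixes p :: "nat \<Rightarrow> 'a :: linorder"
  assumes "inj_on p {..<3}"
  shows "\<exists>a b c. {a, b, c} \<subseteq> {..<3} \<and> p a < p b \<and> p b < p c"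
proof -
  have "p 0 \<noteq> p 1" "p 0 \<noteq> p 2" "p 1 \<noteq> p 2"
    using inj_onD[OF assms, of 0 1] inj_onD[OF assms, of 0 2] inj_onD[OF assms, of 1 2] by auto
  then consider "p 0 < p 1" "p 1 < p 2" | "p 0 < p 2" "p 2 < p 1" | "p 1 < p 0" "p 0 < p 2"
    | "p 1 < p 2" "p 2 < p 0" | "p 2 < p 0" "p 0 < p 1" | "p 2 < p 1" "p 1 < p 0"
    by (meson linorder_neqE)
  then show ?thesis
    by cases (rule exI, rule exI, rule exI, rule conjI[rotated], erule (1) conjI, simp)+
qed

text \<open>A matching of tree edges that are bichromatic under the colouring \<open>P\<close>; an
  edge is represented by its lower end \<open>y\<close>, the upper end being
  \<open>tl y\<close>.\<close>

definition tree_matching :: "(nat list \<Rightarrow> bool) \<Rightarrow> nat list set \<Rightarrow> nat list set \<Rightarrow> bool" where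
  "tree_matching P T M \<longleftrightarrow>
     M \<subseteq> T \<and> tl ` M \<subseteq> T \<and> [] \<notin> M \<and> (\<forall>y\<in>M. P y \<noteq> P (tl y)) \<and>
     pairwise (\<lambda>y z. {y, tl y} \<inter> {z, tl z} = {}) M"

lemma finite_subtree: "finite (subtree t d)"
proof -
  have "subtree t d = (\<lambda>w. w @ t) ` {w. set w \<subseteq> {..<3} \<and> length w \<le> d}"
    by (auto simp: subtree_def)
  then show ?thesis by (simp add: finite_lists_length_le)
qed

text \<open>Among the three subtrees of the root, take the one whose threshold is the median: below that
  threshold there is a node of one of the other subtrees, above it a node of the remaining one, so
  the path joining them through the root contributes one more bichromatic edge.\<close>

lemma tree_matching_exists:
  fixes \<tau> :: "nat list \<Rightarrow> nat"
  assumes "inj_on \<tau> (subtree t d)"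
  shows "\<exists>x\<in>subtree t d. \<exists>M. card M = d \<and> tree_matching (\<lambda>y. \<tau> y \<le> \<tau> x) (subtree t d) M"
  using assms
proof (induction d arbitrary: t)
  case 0
  then show ?case
    by (intro bexI[of _ t] exI[of _ "{}"]) (auto simp: tree_matching_def subtree_def)
next
  case (Suc d)
  have "\<exists>x\<in>subtree (c # t) d. \<exists>M. card M = d \<and>
      tree_matching (\<lambda>y. \<tau> y \<le> \<tau> x) (subtree (c # t) d) M" if "c < 3" for c
    by (rule Suc.IH) (rule inj_on_subset[OF Suc.prems subtree_child[OF that]])
  then obtain x M where x: "\<And>c. c < 3 \<Longrightarrow> x c \<in> subtree (c # t) d"
    and M: "\<And>c. c < 3 \<Longrightarrow> card (M c) = d"
      "\<And>c. c < 3 \<Longrightarrow> tree_matching (\<lambda>y. \<tau> y \<le> \<tau> (x c)) (subtree (c # t) d) (M c)"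
    by metis
  \<comment> \<open>The three thresholds differ because the nodes attaining them lie in disjoint
    subtrees; so they have a strict median.\<close>
  have "inj_on (\<lambda>c. \<tau> (x c)) {..<3}"
  proof (rule inj_onI)
    fix c c' :: nat assume c: "c \<in> {..<3}" "c' \<in> {..<3}" "\<tau> (x c) = \<tau> (x c')"
    then have "x c = x c'"
      using Suc.prems x[of c] x[of c'] subtree_child[of c t d] subtree_child[of c' t d]
      by (auto dest!: inj_onD)
    then show "c = c'" using c x[of c] x[of c'] subtree_children_disjoint[of c c' t d] by auto
  qed
  from three_distinct_sorted[OF this] obtain a b c where
    abc: "a < 3" "b < 3" "c < 3" "\<tau> (x a) < \<tau> (x b)" "\<tau> (x b) < \<tau> (x c)" by auto
  let ?P = "\<lambda>y. \<tau> y \<le> \<tau> (x b)"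
  \<comment> \<open>The colour of \<open>t\<close> decides which outer child is used:
    \<open>x c\<close> lies above the median threshold and \<open>x a\<close> below it, so one of
    them is coloured differently from \<open>t\<close>.\<close>
  obtain e where e: "e < 3" "e \<noteq> b" "?P (x e) \<noteq> ?P t"
  proof (cases "?P t")
    case True then show ?thesis using that[of c] abc by auto
  next
    case False then show ?thesis using that[of a] abc by auto
  qed
  obtain w where w: "x e = (w @ [e]) @ t" "set w \<subseteq> {..<3}" "length w \<le> d"
    using x[OF e(1)] by (auto simp: subtree_def)
  obtain w' f u where u: "w @ [e] = w' @ f # u" "?P (f # u @ t) \<noteq> ?P (u @ t)"
    using exists_change_on_branch[of ?P "w @ [e]" t] e(3) unfolding w(1) by blast
  let ?y = "f # u @ t"
  have len: "length (w @ [e]) \<le> Suc d" and st: "set (w @ [e]) \<subseteq> {..<3}" using w e by auto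
  have y1: "?y \<in> subtree t (Suc d)" and y2: "u @ t \<in> subtree t (Suc d)"
    using len st unfolding u(1) subtree_def by (auto intro!: exI[of _ "f # u"])
  \<comment> \<open>The branch from \<open>x e\<close> enters \<open>t\<close> through the child
    \<open>e\<close>, which is not \<open>b\<close>. Hence neither end of the new edge lies in the
    subtree that contains the matching \<open>M b\<close>; the upper end may be \<open>t\<close>
    itself.\<close>
  have last: "last (f # u) = e" using u(1) by (metis last_append last_snoc list.distinct(1))
  have y3: "?y \<notin> subtree (b # t) d"
  proof
    assume "?y \<in> subtree (b # t) d"
    then obtain v where "(f # u) @ t = (v @ [b]) @ t" by (auto simp: subtree_def)
    then have "f # u = v @ [b]" by blast
    then show False using last e(2) by (metis last_snoc)
  qed
  have y4: "u @ t \<notin> subtree (b # t) d"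
  proof
    assume "u @ t \<in> subtree (b # t) d"
    then obtain v where "u @ t = (v @ [b]) @ t" by (auto simp: subtree_def)
    then have "u = v @ [b]" by blast
    then show False using last e(2) by simp
  qed
  have Mb: "M b \<subseteq> subtree (b # t) d" "tl ` M b \<subseteq> subtree (b # t) d"
    using M(2)[OF abc(2)] by (auto simp: tree_matching_def)
  have "tree_matching ?P (subtree t (Suc d)) (insert ?y (M b))"
  proof -
    have "{?y, u @ t} \<inter> {z, tl z} = {}" if "z \<in> M b" for z
    proof -
      have "z \<in> subtree (b # t) d" "tl z \<in> subtree (b # t) d" using Mb that by auto
      then show ?thesis using y3 y4 by (auto simp del: append_Cons)
    qed
    then have "pairwise (\<lambda>y z. {y, tl y} \<inter> {z, tl z} = {}) (insert ?y (M b))"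
      using M(2)[OF abc(2)] unfolding tree_matching_def pairwise_insert list.sel by blast
    moreover have "insert ?y (M b) \<subseteq> subtree t (Suc d)" "tl ` insert ?y (M b) \<subseteq> subtree t (Suc d)"
      using y1 y2 Mb subtree_child[OF abc(2), of t d] by auto
    ultimately show ?thesis
      using M(2)[OF abc(2)] u(2) unfolding tree_matching_def by simp
  qed
  moreover have "card (insert ?y (M b)) = Suc d"
    using Mb y3 M(1)[OF abc(2)] finite_subset[OF Mb(1) finite_subtree]
    by (subst card_insert_disjoint) auto
  ultimately show ?case using x[OF abc(2)] subtree_child[OF abc(2), of t d] by blast
qed

lemma disjoint_pairs_between:
  assumes "finite A" "finite B" "A \<inter> B = {}" "h \<le> card A" "h \<le> card B"
  shows "\<exists>N \<subseteq> A \<times> B. card N = h \<and> disjoint_pairs N"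
proof -
  obtain A' B' where A': "A' \<subseteq> A" "card A' = h" "finite A'" and B': "B' \<subseteq> B" "card B' = h" "finite B'"
    using assms(4,5) obtain_subset_with_card_n by metis
  obtain f where f: "bij_betw f A' B'"
    using A' B' finite_same_card_bij by metis
  have "disjoint_pairs ((\<lambda>x. (x, f x)) ` A')"
    unfolding disjoint_pairs_def
  proof (rule pairwiseI)
    fix e e' assume e: "e \<in> (\<lambda>x. (x, f x)) ` A'" "e' \<in> (\<lambda>x. (x, f x)) ` A'" "e \<noteq> e'"
    then obtain x y where xy: "x \<in> A'" "y \<in> A'" "x \<noteq> y" "e = (x, f x)" "e' = (y, f y)" by blast
    then have "f x \<noteq> f y" using f by (auto simp: bij_betw_def inj_on_def)
    moreover have "f x \<in> B'" "f y \<in> B'" using f xy by (auto simp: bij_betw_def)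
    ultimately show "{fst e, snd e} \<inter> {fst e', snd e'} = {}"
      using xy A' B' assms(3) by auto
  qed
  moreover have "card ((\<lambda>x. (x, f x)) ` A') = h"
    using A' by (subst card_image) (auto simp: inj_on_def)
  moreover have "(\<lambda>x. (x, f x)) ` A' \<subseteq> A \<times> B"
    using A' B' f by (auto simp: bij_betw_def)
  ultimately show ?thesis by blast
qed

section \<open>Passing from tree nodes to blocks of vertices\<close>

definition adjacent_blocks :: "nat list \<Rightarrow> nat list \<Rightarrow> bool" where
  "adjacent_blocks s t \<longleftrightarrow> s \<noteq> [] \<and> t = tl s \<or> t \<noteq> [] \<and> s = tl t"

text \<open>A block of \<open>2 * h\<close> vertices counts as early from the moment when \<open>h\<close> of its vertices are;
  an early block and a late one then have \<open>h\<close> vertices on either side of the threshold.\<close>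

lemma block_matching_exists:
  fixes \<tau> :: "nat list \<times> nat \<Rightarrow> nat"
  assumes inj: "inj_on \<tau> (subtree [] d \<times> {..<2 * h})" and h: "h > 0"
  shows "\<exists>p M. M \<subseteq> (subtree [] d \<times> {..<2 * h}) \<times> (subtree [] d \<times> {..<2 * h}) \<and>
    card M = d * h \<and> disjoint_pairs M \<and>
    (\<forall>(u, v) \<in> M. \<tau> u < p \<and> p \<le> \<tau> v \<and> adjacent_blocks (fst u) (fst v))"
proof -
  define early where "early t p = {u \<in> {t} \<times> {..<2 * h}. \<tau> u < p}" for t p
  define time where "time t = (LEAST p. h \<le> card (early t p))" for t
  have fin: "finite (early t p)" for t p by (simp add: early_def)
  have mono: "card (early t p) \<le> card (early t q)" if "p \<le> q" for t p q
    using that by (intro card_mono fin) (auto simp: early_def)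
  have ex: "h \<le> card (early t (Suc (Max (\<tau> ` ({t} \<times> {..<2 * h})))))" for t
  proof -
    have "early t (Suc (Max (\<tau> ` ({t} \<times> {..<2 * h})))) = {t} \<times> {..<2 * h}"
      unfolding early_def by (auto simp: less_Suc_eq_le intro!: Max_ge)
    then show ?thesis by (simp add: card_cartesian_product)
  qed
  have time_le: "time t \<le> p \<longleftrightarrow> h \<le> card (early t p)" for t p
  proof
    assume "time t \<le> p"
    moreover have "h \<le> card (early t (time t))" unfolding time_def by (rule LeastI) (rule ex)
    ultimately show "h \<le> card (early t p)" using mono le_trans by blast
  qed (auto simp: time_def intro: Least_le)
  \<comment> \<open>The number of early vertices can reach \<open>h\<close> at \<open>Suc q\<close>
    only if a vertex of the block has stamp \<open>q\<close>. So the time of a block is determined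
    by the stamp of one of its own vertices, and times of distinct blocks differ because \<tau> is
    injective. Time 0 is impossible as \<open>h > 0\<close>.\<close>
  have time_eq: "\<exists>j<2 * h. time t = Suc (\<tau> (t, j))" for t
  proof -
    have "\<not> time t \<le> 0" unfolding time_le using h by (simp add: early_def)
    then obtain q where q: "time t = Suc q" by (cases "time t") auto
    then have "\<not> h \<le> card (early t q)" "h \<le> card (early t (Suc q))"
      using time_le[of t q] time_le[of t "Suc q"] by auto
    then have "\<not> early t (Suc q) \<subseteq> early t q" using card_mono[OF fin, of "early t (Suc q)" t q] by linarith
    then show ?thesis by (auto simp: early_def q less_Suc_eq)
  qed
  have "inj_on time (subtree [] d)"
  proof (rule inj_onI)
    fix s t assume st: "s \<in> subtree [] d" "t \<in> subtree [] d" "time s = time t"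
    obtain i j where "i < 2 * h" "j < 2 * h" "time s = Suc (\<tau> (s, i))" "time t = Suc (\<tau> (t, j))"
      using time_eq by metis
    then have "\<tau> (s, i) = \<tau> (t, j)" "(s, i) \<in> subtree [] d \<times> {..<2 * h}"
      "(t, j) \<in> subtree [] d \<times> {..<2 * h}" using st by simp_all
    then have "(s, i) = (t, j)" by (rule inj_onD[OF inj])
    then show "s = t" by simp
  qed
  from tree_matching_exists[OF this] obtain p M where M: "card M = d"
    "tree_matching (\<lambda>y. time y \<le> p) (subtree [] d) M" by auto
  let ?B = "\<lambda>y. {y, tl y} \<times> {..<2 * h}"
  have "\<exists>N \<subseteq> ?B y \<times> ?B y. card N = h \<and> disjoint_pairs N \<and>
      (\<forall>u v. (u, v) \<in> N \<longrightarrow> \<tau> u < p \<and> p \<le> \<tau> v \<and> adjacent_blocks (fst u) (fst v))" if "y \<in> M" for y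
  proof -
    have y: "(time y \<le> p) \<noteq> (time (tl y) \<le> p)" "y \<noteq> []"
      using M(2) that unfolding tree_matching_def by auto
    obtain s t where st: "{s, t} \<subseteq> {y, tl y}" "time s \<le> p" "\<not> time t \<le> p"
      and adj: "adjacent_blocks s t"
    proof (cases "time y \<le> p")
      case True
      then show ?thesis using y by (intro that[of y "tl y"]) (auto simp: adjacent_blocks_def)
    next
      case False
      then show ?thesis using y by (intro that[of "tl y" y]) (auto simp: adjacent_blocks_def)
    qed
    let ?L = "{u \<in> {t} \<times> {..<2 * h}. p \<le> \<tau> u}"
    have "early t p \<union> ?L = {t} \<times> {..<2 * h}" "early t p \<inter> ?L = {}"
      by (auto simp: early_def)
    then have "card (early t p) + card ?L = 2 * h"
      using card_Un_disjoint[of "early t p" ?L] fin by (simp add: card_cartesian_product)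
    \<comment> \<open>A block that is not early at \<open>p\<close> has fewer than \<open>h\<close>
      early vertices, hence more than \<open>h\<close> of its \<open>2 * h\<close> vertices are
      late.\<close>
    then have "h \<le> card ?L" using st(3) unfolding time_le by linarith
    moreover have "finite ?L" "early s p \<inter> ?L = {}" "h \<le> card (early s p)"
      using st(2) by (auto simp: early_def time_le)
    ultimately have "\<exists>N \<subseteq> early s p \<times> ?L. card N = h \<and> disjoint_pairs N"
      by (intro disjoint_pairs_between fin)
    then obtain N where N: "N \<subseteq> early s p \<times> ?L" "card N = h" "disjoint_pairs N" by blast
    have "early s p \<subseteq> ?B y" "?L \<subseteq> ?B y" using st(1) by (auto simp: early_def)
    then have "N \<subseteq> ?B y \<times> ?B y" using N(1) by blast
    moreover have "\<tau> u < p \<and> p \<le> \<tau> v \<and> adjacent_blocks (fst u) (fst v)" if "(u, v) \<in> N" for u v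
    proof -
      have "u \<in> early s p" "v \<in> ?L" using N(1) that by auto
      then show ?thesis using adj by (auto simp: early_def)
    qed
    ultimately show ?thesis using N by blast
  qed
  then obtain N where N: "\<And>y. y \<in> M \<Longrightarrow> N y \<subseteq> ?B y \<times> ?B y"
    "\<And>y. y \<in> M \<Longrightarrow> card (N y) = h" "\<And>y. y \<in> M \<Longrightarrow> disjoint_pairs (N y)"
    "\<And>y u v. y \<in> M \<Longrightarrow> (u, v) \<in> N y \<Longrightarrow> \<tau> u < p \<and> p \<le> \<tau> v \<and> adjacent_blocks (fst u) (fst v)"
    by metis
  have finM: "finite M" using M(2) finite_subset[OF _ finite_subtree] by (auto simp: tree_matching_def)
  \<comment> \<open>Disjoint tree edges involve disjoint pairs of blocks, so the local matchings can
    be united without collisions, contributing \<open>h\<close> pairs for each of the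
    \<open>d\<close> edges.\<close>
  have disj: "?B y \<inter> ?B z = {}" if "y \<in> M" "z \<in> M" "y \<noteq> z" for y z
    using M(2) that by (auto simp: tree_matching_def pairwise_def)
  have "N y \<inter> N z = {}" if "y \<in> M" "z \<in> M" "y \<noteq> z" for y z
    using N(1)[OF that(1)] N(1)[OF that(2)] disj[OF that] by blast
  moreover have "finite (N y)" if "y \<in> M" for y using N(2)[OF that] h card.infinite by fastforce
  ultimately have "card (\<Union>(N ` M)) = d * h"
    using N(2) M(1) finM by (subst card_UN_disjoint) auto
  moreover have "disjoint_pairs (\<Union>(N ` M))"
    unfolding disjoint_pairs_def
  proof (rule pairwiseI)
    fix e e' assume e: "e \<in> \<Union>(N ` M)" "e' \<in> \<Union>(N ` M)" "e \<noteq> e'"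
    then obtain y z where yz: "y \<in> M" "z \<in> M" "e \<in> N y" "e' \<in> N z" by blast
    show "{fst e, snd e} \<inter> {fst e', snd e'} = {}"
    proof (cases "y = z")
      case True
      then show ?thesis using N(3)[OF yz(1)] yz e(3) by (auto simp: disjoint_pairs_def pairwise_def)
    next
      case False
      have "e \<in> ?B y \<times> ?B y" "e' \<in> ?B z \<times> ?B z" using N(1) yz by blast+
      then have "{fst e, snd e} \<subseteq> ?B y" "{fst e', snd e'} \<subseteq> ?B z" by (auto simp: mem_Times_iff)
      then have "{fst e, snd e} \<inter> {fst e', snd e'} \<subseteq> ?B y \<inter> ?B z" by (rule Int_mono)
      then show ?thesis unfolding disj[OF yz(1,2) False] by (rule subset_empty[THEN iffD1])
    qed
  qed
  moreover have "\<Union>(N ` M) \<subseteq> (subtree [] d \<times> {..<2 * h}) \<times> (subtree [] d \<times> {..<2 * h})"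
  proof (rule UN_least)
    fix y assume "y \<in> M"
    then have B: "?B y \<subseteq> subtree [] d \<times> {..<2 * h}"
      using M(2) by (auto simp: tree_matching_def)
    show "N y \<subseteq> (subtree [] d \<times> {..<2 * h}) \<times> (subtree [] d \<times> {..<2 * h})"
      by (rule subset_trans[OF N(1)[OF \<open>y \<in> M\<close>] Sigma_mono[OF B B]])
  qed
  moreover have "\<forall>(u, v) \<in> \<Union>(N ` M). \<tau> u < p \<and> p \<le> \<tau> v \<and> adjacent_blocks (fst u) (fst v)"
    using N(4) by blast
  ultimately show ?thesis by (intro exI[of _ p] exI[of _ "\<Union>(N ` M)"] conjI)
qed

section \<open>Runs of read-once branching programs\<close>

text \<open>Sinks are made stationary, so that a run is defined for any number of steps.\<close>

definition bstep :: "bprogram \<Rightarrow> (nat \<Rightarrow> bool) \<Rightarrow> nat \<Rightarrow> nat" where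
  "bstep B \<alpha> a = (if a \<in> inner_nodes B then bsucc B a (\<alpha> (blabel B a)) else a)"

abbreviation brun :: "bprogram \<Rightarrow> (nat \<Rightarrow> bool) \<Rightarrow> nat \<Rightarrow> nat" where
  "brun B \<alpha> i \<equiv> (bstep B \<alpha> ^^ i) (broot B)"

definition labels_before :: "bprogram \<Rightarrow> nat \<Rightarrow> nat set" where
  "labels_before B a = blabel B ` {b \<in> inner_nodes B. (b, a) \<in> (bedges B)\<^sup>+}"

text \<open>The label of \<open>a\<close> itself counts here and not in
  \<open>labels_before\<close>, since it is read only on leaving \<open>a\<close>.\<close>

definition labels_after :: "bprogram \<Rightarrow> nat \<Rightarrow> nat set" where
  "labels_after B a = blabel B ` {b \<in> inner_nodes B. (a, b) \<in> (bedges B)\<^sup>*}"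

text \<open>A common label would occur twice on one directed path through \<open>a\<close>, contrary
  to the read-once property.\<close>

lemma labels_disjoint:
  assumes "robp B"
  shows "labels_before B a \<inter> labels_after B a = {}"
proof -
  have "blabel B b \<noteq> blabel B c"
    if "b \<in> inner_nodes B" "c \<in> inner_nodes B" "(b, a) \<in> (bedges B)\<^sup>+" "(a, c) \<in> (bedges B)\<^sup>*" for b c
    using assms that unfolding robp_def by (meson trancl_rtrancl_trancl)
  then show ?thesis by (auto simp: labels_before_def labels_after_def)
qed

lemma labels_before_root: "robp B \<Longrightarrow> labels_before B (broot B) = {}"
  unfolding robp_def labels_before_def by (auto dest: tranclD2)

lemma bstep_inner: "a \<in> inner_nodes B \<Longrightarrow> bstep B \<alpha> a = bsucc B a (\<alpha> (blabel B a))"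
  and bstep_not_inner: "a \<notin> inner_nodes B \<Longrightarrow> bstep B \<alpha> a = a"
  by (simp_all add: bstep_def)

lemma bstep_in_bedges: "a \<in> inner_nodes B \<Longrightarrow> (a, bstep B \<alpha> a) \<in> bedges B"
  by (auto simp: bstep_inner bedges_def)

lemma bstep_reach: "(a, (bstep B \<alpha> ^^ i) a) \<in> (bedges B)\<^sup>*"
proof (induction i)
  case (Suc i)
  have "(b, bstep B \<alpha> b) \<in> (bedges B)\<^sup>*" for b
    by (cases "b \<in> inner_nodes B") (auto intro: bstep_in_bedges simp: bstep_not_inner)
  then show ?case using Suc by (auto intro: rtrancl_trans)
qed simp

lemma true_sink_not_inner: "true_sink B \<notin> inner_nodes B"
  by (simp add: inner_nodes_def)

lemma bstep_true_sink: "(bstep B \<alpha> ^^ i) (true_sink B) = true_sink B"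
  by (induction i) (auto simp: bstep_not_inner true_sink_not_inner)

lemma robp_accepts_iff_brun: "robp_accepts B \<alpha> \<longleftrightarrow> (\<exists>i. brun B \<alpha> i = true_sink B)"
proof
  let ?R = "{(a, bsucc B a (\<alpha> (blabel B a))) | a. a \<in> inner_nodes B}"
  have "\<exists>i. brun B \<alpha> i = b" if "(broot B, b) \<in> ?R\<^sup>*" for b
    using that
  proof (induction rule: rtrancl_induct)
    case base
    show ?case by (rule exI[of _ 0]) simp
  next
    case (step b c)
    then obtain i where "brun B \<alpha> i = b" by blast
    then have "brun B \<alpha> (Suc i) = c" using step(2) by (auto simp: bstep_inner)
    then show ?case by blast
  qed
  then show "robp_accepts B \<alpha> \<Longrightarrow> \<exists>i. brun B \<alpha> i = true_sink B" by (simp add: robp_accepts_def)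
  have "(broot B, brun B \<alpha> i) \<in> ?R\<^sup>*" for i
  proof (induction i)
    case (Suc i)
    then show ?case
      by (cases "brun B \<alpha> i \<in> inner_nodes B")
        (auto simp: bstep_inner bstep_not_inner intro: rtrancl_into_rtrancl)
  qed simp
  then show "robp_accepts B \<alpha>" if "\<exists>i. brun B \<alpha> i = true_sink B"
    using that unfolding robp_accepts_def by (elim exE) (erule subst)
qed

text \<open>Every query that moves the run on its way to the final node is made at a proper
  predecessor of that node, so only labels in its \<open>labels_before\<close> matter.\<close>

lemma bstep_cong_before:
  assumes "\<And>v. v \<in> labels_before B ((bstep B \<alpha> ^^ i) a) \<Longrightarrow> \<alpha> v = \<gamma> v"
  shows "(bstep B \<gamma> ^^ i) a = (bstep B \<alpha> ^^ i) a"
proof -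
  have "(bstep B \<gamma> ^^ l) a = (bstep B \<alpha> ^^ l) a" if "l \<le> i" for l
    using that
  proof (induction l)
    case (Suc l)
    let ?b = "(bstep B \<alpha> ^^ l) a"
    have "bstep B \<gamma> ?b = bstep B \<alpha> ?b"
    proof (cases "?b \<in> inner_nodes B")
      case True
      have "(bstep B \<alpha> ^^ i) a = (bstep B \<alpha> ^^ (i - Suc l)) (bstep B \<alpha> ?b)"
        using Suc.prems by (metis funpow.simps(2) funpow_add le_add_diff_inverse2 o_apply)
      then have "(?b, (bstep B \<alpha> ^^ i) a) \<in> (bedges B)\<^sup>+"
        using bstep_in_bedges[OF True, of \<alpha>] bstep_reach[of "bstep B \<alpha> ?b" "i - Suc l" B \<alpha>]
        by (metis rtrancl_into_trancl2)
      then have "\<alpha> (blabel B ?b) = \<gamma> (blabel B ?b)"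
        using True by (intro assms) (auto simp: labels_before_def)
      then show ?thesis by (simp add: bstep_def)
    qed (simp add: bstep_def)
    then show ?case using Suc by simp
  qed simp
  then show ?thesis by simp
qed

lemma bstep_cong_after:
  assumes "\<And>v. v \<in> labels_after B a \<Longrightarrow> \<alpha> v = \<gamma> v"
  shows "(bstep B \<gamma> ^^ i) a = (bstep B \<alpha> ^^ i) a"
proof (induction i)
  case (Suc i)
  let ?b = "(bstep B \<alpha> ^^ i) a"
  have "bstep B \<gamma> ?b = bstep B \<alpha> ?b"
  proof (cases "?b \<in> inner_nodes B")
    case True
    then have "blabel B ?b \<in> labels_after B a" using bstep_reach by (auto simp: labels_after_def)
    then show ?thesis using assms by (simp add: bstep_inner True)
  qed (simp add: bstep_not_inner)
  then show ?case using Suc by simp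
qed simp

text \<open>A place of the program is a pair of consecutive nodes of the run; the pair
  \<open>(a, a)\<close> is allowed so that a cut before the first step is covered too.\<close>

definition passes :: "bprogram \<Rightarrow> (nat \<Rightarrow> bool) \<Rightarrow> nat \<times> nat \<Rightarrow> bool" where
  "passes B \<alpha> e \<longleftrightarrow> (\<exists>i. brun B \<alpha> i = fst e) \<and> (snd e = fst e \<or> snd e = bstep B \<alpha> (fst e))"

definition mix :: "nat set \<Rightarrow> (nat \<Rightarrow> bool) \<Rightarrow> (nat \<Rightarrow> bool) \<Rightarrow> nat \<Rightarrow> bool" where
  "mix S \<alpha> \<beta> v = (if v \<in> S then \<alpha> v else \<beta> v)"

text \<open>The mixed assignment follows \<open>\<alpha>\<close> up to \<open>a\<close> and \<open>\<beta>\<close> from \<open>a'\<close> on; at \<open>a\<close> it may read the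
  label from either, but both lead to \<open>a'\<close>.\<close>

lemma robp_accepts_mix:
  assumes acc: "robp_accepts B \<beta>"
    and pass: "passes B \<alpha> (a, a')" "passes B \<beta> (a, a')"
    and S: "labels_before B a \<subseteq> S" "S \<inter> labels_after B a' = {}"
  shows "robp_accepts B (mix S \<alpha> \<beta>)"
proof -
  let ?\<gamma> = "mix S \<alpha> \<beta>"
  obtain i where i: "brun B \<alpha> i = a" using pass(1) by (auto simp: passes_def)
  have \<gamma>a: "brun B ?\<gamma> i = a"
    using bstep_cong_before[where B = B and \<alpha> = \<alpha> and \<gamma> = ?\<gamma> and i = i and a = "broot B"] S(1)
    unfolding i by (metis mix_def subsetD)
  have "\<exists>j. brun B ?\<gamma> j = a'"
  proof (cases "a' = a")
    case True
    then show ?thesis using \<gamma>a by blast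
  next
    case False
    then have "bstep B \<alpha> a = a'" "bstep B \<beta> a = a'" using pass by (auto simp: passes_def)
    then have "bstep B ?\<gamma> a = a'" by (auto simp: bstep_def mix_def)
    then have "brun B ?\<gamma> (Suc i) = a'" using \<gamma>a by simp
    then show ?thesis by blast
  qed
  then obtain j where j: "brun B ?\<gamma> j = a'" ..
  have "\<exists>k. brun B \<beta> k = a'"
  proof -
    obtain k where k: "brun B \<beta> k = a" "a' = a \<or> a' = bstep B \<beta> a"
      using pass(2) by (auto simp: passes_def)
    then have "brun B \<beta> k = a' \<or> brun B \<beta> (Suc k) = a'" by auto
    then show ?thesis by blast
  qed
  then obtain k where k: "brun B \<beta> k = a'" ..
  obtain L where L: "brun B \<beta> L = true_sink B" using acc by (auto simp: robp_accepts_iff_brun)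
  \<comment> \<open>Counted from \<open>a'\<close>, \<open>L\<close> steps may be more than
    necessary, but the surplus is spent in the stationary true sink.\<close>
  have "(bstep B \<beta> ^^ L) a' = brun B \<beta> (k + L)"
    using k by (simp add: funpow_add add.commute[of k L])
  also have "\<dots> = true_sink B" by (simp add: funpow_add L bstep_true_sink)
  finally have "(bstep B ?\<gamma> ^^ L) a' = true_sink B"
    using bstep_cong_after[where B = B and \<alpha> = \<beta> and \<gamma> = ?\<gamma> and i = L and a = a'] S(2)
    by (metis disjoint_iff mix_def)
  then have "brun B ?\<gamma> (L + j) = true_sink B" by (simp add: funpow_add j)
  then show ?thesis unfolding robp_accepts_iff_brun by blast
qed

lemma brun_in_bnodes: "robp B \<Longrightarrow> brun B \<alpha> i \<in> bnodes B"
proof (induction i)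
  case (Suc i)
  then have "bedges B \<subseteq> bnodes B \<times> bnodes B" "brun B \<alpha> i \<in> bnodes B" by (auto simp: robp_def)
  then show ?case using bstep_in_bedges[of "brun B \<alpha> i" B \<alpha>]
    by (cases "brun B \<alpha> i \<in> inner_nodes B") (auto simp: bstep_not_inner)
qed (simp add: robp_def)

lemma labels_after_antimono: "(a, b) \<in> (bedges B)\<^sup>* \<Longrightarrow> labels_after B b \<subseteq> labels_after B a"
  unfolding labels_after_def by (auto intro: rtrancl_trans)

text \<open>The time stamp \<open>\<iota>\<close> below is the first step of the run after which a variable is never queried
  any more; breaking ties arbitrarily, each initial segment of the variables in this order contains
  what was queried before one node of the run and avoids what is queried after the next.\<close>

lemma robp_size_from_cuts:
  assumes "robp B" "finite I"
    and acc: "\<And>x. x \<in> I \<Longrightarrow> robp_accepts B (\<alpha> x)"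
    and cut: "\<And>\<iota> :: nat \<Rightarrow> nat. \<exists>i q. good {v. \<iota> v < i \<or> \<iota> v = i \<and> v < (q::nat)}"
    and bound: "\<And>S J. good S \<Longrightarrow> J \<subseteq> I \<Longrightarrow>
      (\<And>x y. x \<in> J \<Longrightarrow> y \<in> J \<Longrightarrow> robp_accepts B (mix S (\<alpha> x) (\<alpha> y))) \<Longrightarrow> card J \<le> K"
  shows "card I \<le> robp_size B ^ 2 * K"
proof -
  \<comment> \<open>The set \<open>S\<close> found for an assignment depends on its run, but
    membership in \<open>?O\<close> provides for each pair a single \<open>S\<close> that serves all
    assignments passing it. Summing over the pairs gives the square of the size.\<close>
  let ?O = "{e \<in> bnodes B \<times> bnodes B. \<exists>S. good S \<and>
    labels_before B (fst e) \<subseteq> S \<and> S \<inter> labels_after B (snd e) = {}}"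
  let ?J = "\<lambda>e. {x \<in> I. passes B (\<alpha> x) e}"
  have "\<exists>e\<in>?O. passes B (\<alpha> x) e" if "x \<in> I" for x
  proof -
    define \<iota> :: "nat \<Rightarrow> nat" where "\<iota> v = (LEAST i. v \<notin> labels_after B (brun B (\<alpha> x) i))" for v
    \<comment> \<open>The run ends in the true sink, from which no label can be read; so the least
      index in \<iota> exists.\<close>
    have last: "\<exists>i. v \<notin> labels_after B (brun B (\<alpha> x) i)" for v
    proof -
      obtain L where L: "brun B (\<alpha> x) L = true_sink B"
        using acc[OF \<open>x \<in> I\<close>] by (auto simp: robp_accepts_iff_brun)
      have "b \<notin> inner_nodes B" if "(true_sink B, b) \<in> (bedges B)\<^sup>*" for b
        using that by (cases rule: converse_rtranclE) (auto simp: bedges_def inner_nodes_def)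
      then have "v \<notin> labels_after B (brun B (\<alpha> x) L)" by (auto simp: L labels_after_def)
      then show ?thesis by blast
    qed
    obtain i q where S: "good {v. \<iota> v < i \<or> \<iota> v = i \<and> v < q}" (is "good ?S")
      using cut by blast
    \<comment> \<open>\<open>?S\<close> contains all \<open>v\<close> with
      \<open>\<iota> v < i\<close> and only such with \<open>\<iota> v \<le> i\<close>: the former
      include everything read before node \<open>i - 1\<close>, the latter are not read from node
      \<open>i\<close> on. For \<open>i = 0\<close> truncated subtraction makes both components the
      root.\<close>
    let ?e = "(brun B (\<alpha> x) (i - 1), brun B (\<alpha> x) i)"
    have "labels_before B (fst ?e) \<subseteq> ?S"
    proof (cases i)
      case 0
      then show ?thesis using labels_before_root[OF assms(1)] by simp
    next
      case (Suc k)
      have "\<iota> v \<le> k" if "v \<in> labels_before B (brun B (\<alpha> x) k)" for v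
        using that labels_disjoint[OF assms(1), of "brun B (\<alpha> x) k"] unfolding \<iota>_def
        by (intro Least_le) blast
      then show ?thesis using Suc by fastforce
    qed
    moreover have "?S \<inter> labels_after B (snd ?e) = {}"
    proof -
      have "v \<notin> labels_after B (brun B (\<alpha> x) i)" if "\<iota> v \<le> i" for v
      proof -
        have "v \<notin> labels_after B (brun B (\<alpha> x) (\<iota> v))"
          unfolding \<iota>_def by (rule LeastI_ex) (rule last)
        moreover have "brun B (\<alpha> x) i = (bstep B (\<alpha> x) ^^ (i - \<iota> v)) (brun B (\<alpha> x) (\<iota> v))"
          using that by (metis funpow_add le_add_diff_inverse2 o_apply)
        then have "(brun B (\<alpha> x) (\<iota> v), brun B (\<alpha> x) i) \<in> (bedges B)\<^sup>*"
          using bstep_reach by metis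
        ultimately show ?thesis using labels_after_antimono by blast
      qed
      then show ?thesis by auto
    qed
    ultimately have "?e \<in> ?O" using S brun_in_bnodes[OF assms(1)] by auto
    moreover have "passes B (\<alpha> x) ?e"
      by (cases i) (auto simp: passes_def intro: exI[of _ 0])
    ultimately show ?thesis by blast
  qed
  then have "I \<subseteq> (\<Union>e\<in>?O. ?J e)" by (intro subsetI) (simp del: mem_Collect_eq, simp)
  moreover have finO: "finite ?O" using assms(1) by (simp add: robp_def)
  ultimately have "card I \<le> card (\<Union>e\<in>?O. ?J e)"
    using assms(2) by (intro card_mono) auto
  also have "\<dots> \<le> (\<Sum>e\<in>?O. card (?J e))" by (rule card_UN_le[OF finO])
  also have "\<dots> \<le> (\<Sum>e\<in>?O. K)"
  proof (rule sum_mono)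
    fix e assume "e \<in> ?O"
    then obtain S where S: "good S" "labels_before B (fst e) \<subseteq> S" "S \<inter> labels_after B (snd e) = {}"
      by auto
    show "card (?J e) \<le> K"
    proof (rule bound[OF S(1)])
      fix x y assume "x \<in> ?J e" "y \<in> ?J e"
      then show "robp_accepts B (mix S (\<alpha> x) (\<alpha> y))"
        using robp_accepts_mix[of B "\<alpha> y" "\<alpha> x" "fst e" "snd e" S] acc S(2,3) by simp
    qed simp
  qed
  also have "\<dots> = card ?O * K" by simp
  also have "\<dots> \<le> card (bnodes B \<times> bnodes B) * K"
    using assms(1) by (intro mult_right_mono card_mono) (auto simp: robp_def)
  finally show ?thesis by (simp add: robp_size_def card_cartesian_product power2_eq_square)
qed

section \<open>The tree formulas\<close>

text \<open>The list has one entry for a vertex variable and two for an edge variable, so one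
  injective encoding keeps the two kinds apart.\<close>

definition vx :: "nat list \<Rightarrow> nat \<Rightarrow> nat" where "vx t j = to_nat (t, [j])"

text \<open>The variable of the edge from vertex \<open>j\<close> in the block of \<open>y\<close> to vertex \<open>i\<close> in the block of its
  parent.\<close>

definition ex :: "nat list \<Rightarrow> nat \<Rightarrow> nat \<Rightarrow> nat" where "ex y i j = to_nat (y, [i, j])"

lemma vx_ex_simps [simp]:
  "vx s i = vx t j \<longleftrightarrow> s = t \<and> i = j" "ex s i j = ex t i' j' \<longleftrightarrow> s = t \<and> i = i' \<and> j = j'"
  "vx s i \<noteq> ex t i' j'" "ex t i' j' \<noteq> vx s i"
  by (auto simp: vx_def ex_def)

definition tree_cnf :: "nat \<Rightarrow> nat \<Rightarrow> cnf" where
  "tree_cnf d k = (\<lambda>(y, i, j). {Pos (vx (tl y) i), Pos (ex y i j), Pos (vx y j)}) `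
     ((subtree [] d - {[]}) \<times> {..<k} \<times> {..<k})"

definition edge_sat :: "nat \<Rightarrow> (nat \<Rightarrow> bool) \<Rightarrow> nat list \<Rightarrow> bool" where
  "edge_sat k \<alpha> y \<longleftrightarrow> (\<forall>i<k. \<forall>j<k. \<alpha> (vx (tl y) i) \<or> \<alpha> (ex y i j) \<or> \<alpha> (vx y j))"

lemma is_cnf_tree_cnf: "is_cnf (tree_cnf d k)"
  by (auto simp: is_cnf_def tree_cnf_def finite_subtree)

lemma cnf_sat_tree_cnf:
  "cnf_sat \<alpha> (tree_cnf d k) \<longleftrightarrow> (\<forall>y\<in>subtree [] d - {[]}. edge_sat k \<alpha> y)"
  by (auto simp: cnf_sat_def tree_cnf_def edge_sat_def)

text \<open>An edge variable is true only where its clause needs it. Therefore a true edge variable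
  reveals that both ends are false, and a mixture of two such assignments can violate a clause.
  Numbers that encode no variable get \<open>False\<close>.\<close>

definition canonical :: "(nat list \<times> nat) set \<Rightarrow> nat \<Rightarrow> bool" where
  "canonical X n = (case from_nat n of
     (t, [j]) \<Rightarrow> (t, j) \<in> X
   | (y, [i, j]) \<Rightarrow> (tl y, i) \<notin> X \<and> (y, j) \<notin> X
   | _ \<Rightarrow> False)"

lemma canonical_simps [simp]:
  "canonical X (vx t j) \<longleftrightarrow> (t, j) \<in> X"
  "canonical X (ex y i j) \<longleftrightarrow> (tl y, i) \<notin> X \<and> (y, j) \<notin> X"
  by (simp_all add: canonical_def vx_def ex_def)

text \<open>Translates a threshold on the packed number \<open>x * N + a\<close> into a
  lexicographic threshold on \<open>(x, a)\<close>, the form in which cuts of a run are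
  given.\<close>

lemma less_lexicographic_div_mod:
  fixes x a p N :: nat
  assumes "a < N"
  shows "x * N + a < p \<longleftrightarrow> x < p div N \<or> x = p div N \<and> a < p mod N"
proof -
  have p: "p div N * N + p mod N = p" by simp
  have m: "p mod N < N" using assms by simp
  consider "x < p div N" | "x = p div N" | "x > p div N" by linarith
  then show ?thesis
  proof cases
    case 1
    then have "Suc x * N \<le> p div N * N" by (intro mult_le_mono1) simp
    then have "x * N + a < p" using p assms unfolding mult_Suc by linarith
    then show ?thesis using 1 by blast
  next
    case 2
    then show ?thesis using p by (metis add_less_cancel_left less_irrefl)
  next
    case 3
    then have "Suc (p div N) * N \<le> x * N" by (intro mult_le_mono1) simp
    then have "\<not> x * N + a < p" using p m unfolding mult_Suc by linarith
    then show ?thesis using 3 by auto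
  qed
qed

text \<open>All \<open>2 ^ card V\<close> canonical assignments are accepted, a pair of nodes serves
  at most the fraction \<open>(3/4)^(d * h)\<close> of them, and there are at most
  \<open>robp_size B ^ 2\<close> pairs.\<close>

lemma tree_cnf_robp_size:
  assumes B: "robp B" "robp_computes B (tree_cnf d (2 * h))" and h: "h > 0"
  shows "4 ^ (d * h) \<le> robp_size B ^ 2 * 3 ^ (d * h)"
proof -
  let ?V = "subtree [] d \<times> {..<2 * h}"
  let ?enc = "\<lambda>(t, j). vx t j"
  let ?m = "d * h"
  let ?K = "3 ^ ?m * 2 ^ card ?V div 4 ^ ?m :: nat"
  define good where "good S \<longleftrightarrow> (\<exists>M. M \<subseteq> ?V \<times> ?V \<and> card M = ?m \<and> disjoint_pairs M \<and>
    (\<forall>u v. (u, v) \<in> M \<longrightarrow> ?enc u \<in> S \<and> ?enc v \<notin> S \<and> adjacent_blocks (fst u) (fst v)))" for S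
  have finV: "finite ?V" by (simp add: finite_subtree)
  have "card (Pow ?V) \<le> robp_size B ^ 2 * ?K"
  proof (rule robp_size_from_cuts[where \<alpha> = canonical and good = good])
    show "robp B" "finite (Pow ?V)" using B(1) finV by auto
    show "robp_accepts B (canonical X)" for X
    proof -
      have "cnf_sat (canonical X) (tree_cnf d (2 * h))"
        by (auto simp: cnf_sat_tree_cnf edge_sat_def)
      then show ?thesis using B(2) by (auto simp: robp_computes_def)
    qed
  next
    fix \<iota> :: "nat \<Rightarrow> nat"
    define N where "N = Suc (Max (?enc ` ?V))"
    \<comment> \<open>The tie-breaking variable number is smaller than \<open>N\<close>, so it is
      recovered modulo \<open>N\<close>; this makes \<tau> injective as the block lemma
      requires.\<close>
    define \<tau> where "\<tau> u = \<iota> (?enc u) * N + ?enc u" for u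
    have less_N: "?enc u < N" if "u \<in> ?V" for u
      using that finV unfolding N_def less_Suc_eq_le by (intro Max_ge) auto
    have "inj_on \<tau> ?V"
    proof (rule inj_onI)
      fix u v assume uv: "u \<in> ?V" "v \<in> ?V" "\<tau> u = \<tau> v"
      then have "\<tau> u mod N = \<tau> v mod N" by simp
      then have "?enc u = ?enc v" using less_N[OF uv(1)] less_N[OF uv(2)] by (simp add: \<tau>_def)
      then show "u = v" by (auto split: prod.splits)
    qed
    from block_matching_exists[OF this h] obtain p M where M: "M \<subseteq> ?V \<times> ?V" "card M = ?m"
      "disjoint_pairs M" "\<forall>(u, v) \<in> M. \<tau> u < p \<and> p \<le> \<tau> v \<and> adjacent_blocks (fst u) (fst v)"
      by blast
    let ?S = "{v. \<iota> v < p div N \<or> \<iota> v = p div N \<and> v < p mod N}"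
    have S: "?enc u \<in> ?S \<longleftrightarrow> \<tau> u < p" if "u \<in> ?V" for u
      using less_lexicographic_div_mod[OF less_N[OF that], of "\<iota> (?enc u)" p] unfolding \<tau>_def by blast
    have "?enc u \<in> ?S \<and> ?enc v \<notin> ?S \<and> adjacent_blocks (fst u) (fst v)" if "(u, v) \<in> M" for u v
    proof -
      have "u \<in> ?V" "v \<in> ?V" using M(1) that by blast+
      moreover have "\<tau> u < p" "\<not> \<tau> v < p" "adjacent_blocks (fst u) (fst v)" using M(4) that by auto
      ultimately show ?thesis using S by blast
    qed
    then have "good ?S" unfolding good_def using M(1,2,3) by blast
    then show "\<exists>i q. good {v. \<iota> v < i \<or> \<iota> v = i \<and> v < q}" by blast
  next
    fix S J assume "good S" and J: "J \<subseteq> Pow ?V"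
      and mixed: "\<And>X Y. X \<in> J \<Longrightarrow> Y \<in> J \<Longrightarrow> robp_accepts B (mix S (canonical X) (canonical Y))"
    from \<open>good S\<close> obtain M where M: "M \<subseteq> ?V \<times> ?V" "card M = ?m" "disjoint_pairs M"
      "\<And>u v. (u, v) \<in> M \<Longrightarrow> ?enc u \<in> S \<and> ?enc v \<notin> S \<and> adjacent_blocks (fst u) (fst v)"
      unfolding good_def by metis
    have "card J * 4 ^ card M \<le> 3 ^ card M * 2 ^ card ?V"
    proof (rule card_family_disjoint_pairs[OF _ finV J M(3)])
      show "finite M" by (rule finite_subset[OF M(1)]) (intro finite_cartesian_product finV)
    next
      fix u v assume uv: "(u, v) \<in> M"
      then show "u \<in> ?V \<and> v \<in> ?V \<and> u \<noteq> v" using M(1) M(4)[OF uv] by blast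
      obtain s i t j where st: "u = (s, i)" "v = (t, j)" by fastforce
      have V: "s \<in> subtree [] d" "t \<in> subtree [] d" "i < 2 * h" "j < 2 * h"
        using M(1) uv st by auto
      have S: "vx s i \<in> S" "vx t j \<notin> S" using M(4)[OF uv] st by auto
      show "(\<forall>X\<in>J. v \<in> X \<longrightarrow> u \<in> X) \<or> (\<forall>X\<in>J. u \<in> X \<longrightarrow> v \<in> X)"
      proof (rule ccontr)
        assume "\<not> ?thesis"
        \<comment> \<open>With both patterns present, the mixture takes \<open>u\<close> from
          \<open>X\<close> and \<open>v\<close> from \<open>Y\<close>, both false. The edge variable
          is false in either source, since \<open>X\<close> contains \<open>v\<close> and
          \<open>Y\<close> contains \<open>u\<close>; so whichever side of \<open>S\<close> it lies
          on, its clause fails.\<close>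
        then obtain X Y where XY: "X \<in> J" "Y \<in> J" "v \<in> X" "u \<notin> X" "u \<in> Y" "v \<notin> Y" by auto
        let ?\<gamma> = "mix S (canonical X) (canonical Y)"
        have sat: "\<forall>y\<in>subtree [] d - {[]}. edge_sat (2 * h) ?\<gamma> y"
          using mixed[OF XY(1,2)] B(2) by (simp add: robp_computes_def cnf_sat_tree_cnf)
        consider "s \<noteq> []" "t = tl s" | "t \<noteq> []" "s = tl t"
          using M(4)[OF uv] st by (auto simp: adjacent_blocks_def)
        then show False
        proof cases
          case 1
          then have "?\<gamma> (vx t j) \<or> ?\<gamma> (ex s j i) \<or> ?\<gamma> (vx s i)"
            using sat V unfolding edge_sat_def by blast
          then show False using XY S st 1 by (simp add: mix_def split: if_splits)
        next
          case 2
          then have "?\<gamma> (vx s i) \<or> ?\<gamma> (ex t i j) \<or> ?\<gamma> (vx t j)"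
            using sat V unfolding edge_sat_def by blast
          then show False using XY S st 2 by (simp add: mix_def split: if_splits)
        qed
      qed
    qed
    then show "card J \<le> ?K" by (simp add: M(2) less_eq_div_iff_mult_less_eq)
  qed
  \<comment> \<open>Multiplying by \<open>4 ^ ?m\<close> removes the rounded division in
    \<open>?K\<close>.\<close>
  then have "2 ^ card ?V * 4 ^ ?m \<le> robp_size B ^ 2 * (?K * 4 ^ ?m)"
    using mult_le_mono1[of _ _ "4 ^ ?m"] finV by (simp add: card_Pow mult.assoc)
  also have "\<dots> \<le> robp_size B ^ 2 * (3 ^ ?m * 2 ^ card ?V)"
    by (intro mult_le_mono2) simp
  finally have "2 ^ card ?V * 4 ^ ?m \<le> 2 ^ card ?V * (robp_size B ^ 2 * 3 ^ ?m)"
    by (simp add: mult_ac)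
  then show ?thesis by (subst (asm) mult_le_cancel1) simp
qed

section \<open>The decision-DNNF\<close>

datatype dgate = GTrue | GVar nat | GNeg nat
  | GSub "nat list" "bool list" "bool list"
  | GDec "nat list" "bool list" "bool list" bool

instance dgate :: countable by countable_datatype

definition tree_vars :: "nat \<Rightarrow> nat \<Rightarrow> nat set" where
  "tree_vars d k = (\<lambda>(t, j). vx t j) ` (subtree [] d \<times> {..<k}) \<union>
     (\<lambda>(y, i, j). ex y i j) ` ((subtree [] d - {[]}) \<times> {..<k} \<times> {..<k})"

fun dgate_kind :: "nat \<Rightarrow> dgate \<Rightarrow> gate_kind" where
  "dgate_kind k GTrue = ConstG True"
| "dgate_kind k (GVar v) = VarG v"
| "dgate_kind k (GNeg v) = NotG"
| "dgate_kind k (GSub t s w) = (if length w < k then OrG else AndG)"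
| "dgate_kind k (GDec t s w b) = AndG"

text \<open>Once the block of \<open>t\<close> is known, a clause on the edge to the parent is
  either satisfied by \<open>s\<close> or \<open>w\<close> or reduces to its edge variable. Each
  child receives \<open>w\<close> as its parent block. \<open>GTrue\<close> keeps the conjunction
  nonempty where nothing else remains, as at the root of a tree of height 0.\<close>

fun dgate_in :: "nat \<Rightarrow> nat \<Rightarrow> dgate \<Rightarrow> dgate set" where
  "dgate_in d k GTrue = {}"
| "dgate_in d k (GVar v) = {}"
| "dgate_in d k (GNeg v) = {GVar v}"
| "dgate_in d k (GSub t s w) =
     (if length w < k then {GDec t s w True, GDec t s w False}
      else {GTrue} \<union> {GSub (c # t) w [] | c. c < 3 \<and> length t < d} \<union>
        {GVar (ex t i j) | i j. i < k \<and> j < k \<and> t \<noteq> [] \<and> \<not> s ! i \<and> \<not> w ! j})"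
| "dgate_in d k (GDec t s w b) =
     {if b then GVar (vx t (length w)) else GNeg (vx t (length w)), GSub t s (w @ [b])}"

text \<open>\<open>GSub t s w\<close> computes the part of the formula at and below the edge from \<open>t\<close> to its parent,
  when the parent block is assigned \<open>s\<close> and the block of \<open>t\<close> is known to start with \<open>w\<close>. The root
  has no parent edge, so its \<open>s\<close> is irrelevant.\<close>

definition dgates :: "nat \<Rightarrow> nat \<Rightarrow> dgate set" where
  "dgates d k = {GTrue} \<union> GVar ` tree_vars d k \<union> GNeg ` tree_vars d k \<union>
     {GSub t s w | t s w. t \<in> subtree [] d \<and> length s = k \<and> length w \<le> k} \<union>
     {GDec t s w b | t s w b. t \<in> subtree [] d \<and> length s = k \<and> length w < k}"

lemma dgates_iff [simp]:
  "GTrue \<in> dgates d k"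
  "GVar v \<in> dgates d k \<longleftrightarrow> v \<in> tree_vars d k"
  "GNeg v \<in> dgates d k \<longleftrightarrow> v \<in> tree_vars d k"
  "GSub t s w \<in> dgates d k \<longleftrightarrow> t \<in> subtree [] d \<and> length s = k \<and> length w \<le> k"
  "GDec t s w b \<in> dgates d k \<longleftrightarrow> t \<in> subtree [] d \<and> length s = k \<and> length w < k"
  by (auto simp: dgates_def)

lemma mem_tree_vars [simp]:
  "vx t j \<in> tree_vars d k \<longleftrightarrow> t \<in> subtree [] d \<and> j < k"
  "ex t i j \<in> tree_vars d k \<longleftrightarrow> t \<in> subtree [] d \<and> t \<noteq> [] \<and> i < k \<and> j < k"
  by (auto simp: tree_vars_def image_iff)

section \<open>The circuit on numbered gates: well-formedness, acyclicity and size\<close>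

definition tree_circuit :: "nat \<Rightarrow> nat \<Rightarrow> circuit" where
  "tree_circuit d k = \<lparr>gates = to_nat ` dgates d k,
     wires = {(to_nat h, to_nat g) | h g. g \<in> dgates d k \<and> h \<in> dgate_in d k g},
     gkind = (\<lambda>n. dgate_kind k (from_nat n)),
     outgate = to_nat (GSub [] (replicate k True) [])\<rparr>"

lemma tree_circuit_simps [simp]:
  "gates (tree_circuit d k) = to_nat ` dgates d k"
  "gkind (tree_circuit d k) (to_nat g) = dgate_kind k g"
  "outgate (tree_circuit d k) = to_nat (GSub [] (replicate k True) [])"
  by (simp_all add: tree_circuit_def)

lemma in_nbrs_tree_circuit:
  "g \<in> dgates d k \<Longrightarrow> in_nbrs (tree_circuit d k) (to_nat g) = to_nat ` dgate_in d k g"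
  by (auto simp: tree_circuit_def in_nbrs_def)

lemma subtree_nil: "subtree [] d = {w. set w \<subseteq> {..<3} \<and> length w \<le> d}"
  by (auto simp: subtree_def)

lemma dgate_in_closed: "g \<in> dgates d k \<Longrightarrow> h \<in> dgate_in d k g \<Longrightarrow> h \<in> dgates d k"
proof (cases g)
  case (GSub t s w)
  assume "g \<in> dgates d k" "h \<in> dgate_in d k g"
  then have t: "t \<in> subtree [] d" "length s = k" "length w \<le> k" and h: "h \<in> dgate_in d k (GSub t s w)"
    unfolding GSub by simp_all
  show ?thesis
  proof (cases "length w < k")
    case True
    then show ?thesis using t h by auto
  next
    case False
    then have "length w = k" using t by simp
    then show ?thesis using t h False by (auto simp: subtree_nil)
  qed
next
  case (GDec t s w b)
  assume "g \<in> dgates d k" "h \<in> dgate_in d k g"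
  then show ?thesis unfolding GDec by (auto split: if_splits)
qed auto

text \<open>Orders gates by remaining depth, then by the number of undecided block variables: the
  factor \<open>k + 1\<close> lets one tree level outweigh a whole block, and the doubling leaves
  room for \<open>GDec\<close> between successive \<open>GSub\<close> gates. The rank also drives
  the induction for correctness.\<close>

fun dgate_rank :: "nat \<Rightarrow> nat \<Rightarrow> dgate \<Rightarrow> nat" where
  "dgate_rank d k GTrue = 0"
| "dgate_rank d k (GVar v) = 0"
| "dgate_rank d k (GNeg v) = 1"
| "dgate_rank d k (GSub t s w) = 2 + 2 * ((d - length t) * (k + 1) + (k - length w))"
| "dgate_rank d k (GDec t s w b) = 1 + 2 * ((d - length t) * (k + 1) + (k - length w))"

lemma dgate_rank_less:
  assumes "g \<in> dgates d k" "h \<in> dgate_in d k g"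
  shows "dgate_rank d k h < dgate_rank d k g"
proof (cases g)
  case (GSub t s w)
  show ?thesis
  proof (cases "\<exists>c. h = GSub (c # t) w [] \<and> length t < d")
    case True
    then have "length t < d" by blast
    then have "d - length t = Suc (d - Suc (length t))" by linarith
    then show ?thesis using True GSub by auto
  next
    case False
    then show ?thesis using assms GSub by (auto split: if_splits)
  qed
qed (use assms in auto)

lemma acyclic_tree_circuit: "acyclic (wires (tree_circuit d k))"
proof -
  have "wires (tree_circuit d k) \<subseteq> measure (\<lambda>n. dgate_rank d k (from_nat n))"
    by (auto simp: tree_circuit_def dgate_rank_less)
  then show ?thesis by (meson wf_acyclic wf_measure wf_subset)
qed

lemma finite_tree_vars: "finite (tree_vars d k)"
  by (simp add: tree_vars_def finite_subtree)

lemma finite_bool_lists: "finite {w :: bool list. length w \<le> k}" "finite {w :: bool list. length w = k}"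
  using finite_lists_length_le[of "UNIV :: bool set" k] finite_lists_length_eq[of "UNIV :: bool set" k]
  by auto

lemma card_bool_lists:
  "card {w :: bool list. length w \<le> k} \<le> 2 ^ Suc k" "card {w :: bool list. length w = k} = 2 ^ k"
proof -
  have "(\<Sum>i\<le>k. 2 ^ i) < (2 ^ Suc k :: nat)" by (induction k) auto
  then show "card {w :: bool list. length w \<le> k} \<le> 2 ^ Suc k"
    using card_lists_length_le[of "UNIV :: bool set" k] by simp
  show "card {w :: bool list. length w = k} = 2 ^ k"
    using card_lists_length_eq[of "UNIV :: bool set" k] by simp
qed

text \<open>A gate for a subproblem stores a tree node and two bit strings, one of length
  \<open>k\<close> and one of length at most \<open>k\<close>. The factor 6 is 3 for
  \<open>GSub\<close> and the two kinds of \<open>GDec\<close>, times 2 for admitting all shorter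
  prefixes.\<close>

lemma dgates_size:
  "finite (dgates d k)"
  "card (dgates d k) \<le> 1 + 2 * card (tree_vars d k) + 6 * (card (subtree [] d) * 4 ^ k)"
proof -
  let ?L = "subtree [] d \<times> {s :: bool list. length s = k} \<times> {w :: bool list. length w \<le> k}"
  let ?G = "{GTrue} \<union> GVar ` tree_vars d k \<union> GNeg ` tree_vars d k \<union>
    (\<lambda>(t, s, w). GSub t s w) ` ?L \<union> (\<lambda>(t, s, w). GDec t s w True) ` ?L \<union>
    (\<lambda>(t, s, w). GDec t s w False) ` ?L"
  have sub: "dgates d k \<subseteq> ?G"
  proof
    fix g assume "g \<in> dgates d k"
    then consider "g \<in> {GTrue} \<union> GVar ` tree_vars d k \<union> GNeg ` tree_vars d k"
      | t s w where "g = GSub t s w" "(t, s, w) \<in> ?L" | t s w b where "g = GDec t s w b" "(t, s, w) \<in> ?L"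
    proof (cases g)
      case (GSub t s w)
      then show ?thesis using that(2) \<open>g \<in> dgates d k\<close> by simp
    next
      case (GDec t s w b)
      then show ?thesis using that(3) \<open>g \<in> dgates d k\<close> by simp
    qed (use that(1) \<open>g \<in> dgates d k\<close> in auto)
    then show "g \<in> ?G"
    proof cases
      case 1
      show ?thesis by (rule UnI1, rule UnI1, rule UnI1) (rule 1)
    next
      case (2 t s w)
      then have "g \<in> (\<lambda>(t, s, w). GSub t s w) ` ?L" by (intro image_eqI[of _ _ "(t, s, w)"]) simp_all
      then show ?thesis by (intro UnI1[OF UnI1[OF UnI2]])
    next
      case (3 t s w b)
      show ?thesis
      proof (cases b)
        case True
        then have "g \<in> (\<lambda>(t, s, w). GDec t s w True) ` ?L"
          using 3 by (intro image_eqI[of _ _ "(t, s, w)"]) simp_all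
        then show ?thesis by (intro UnI1[OF UnI2])
      next
        case False
        then have "g \<in> (\<lambda>(t, s, w). GDec t s w False) ` ?L"
          using 3 by (intro image_eqI[of _ _ "(t, s, w)"]) simp_all
        then show ?thesis by (rule UnI2)
      qed
    qed
  qed
  have finL: "finite ?L" by (simp add: finite_subtree finite_bool_lists)
  then have finG: "finite ?G" by (simp add: finite_tree_vars)
  then show "finite (dgates d k)" using sub finite_subset by blast
  have "card ?L \<le> card (subtree [] d) * (2 ^ k * 2 ^ Suc k)"
    unfolding card_cartesian_product by (intro mult_le_mono card_bool_lists order_refl eq_refl)
  also have "\<dots> = 2 * (card (subtree [] d) * 4 ^ k)"
    by (simp add: power_mult_distrib[symmetric])
  finally have L: "card ?L \<le> 2 * (card (subtree [] d) * 4 ^ k)" .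
  have "card (dgates d k) \<le> card ?G" using finG sub by (rule card_mono)
  also have "\<dots> \<le> 1 + card (tree_vars d k) + card (tree_vars d k) + card ?L + card ?L + card ?L"
    by (intro order_trans[OF card_Un_le] add_mono card_image_le finite_tree_vars finL) simp
  finally show "card (dgates d k) \<le> 1 + 2 * card (tree_vars d k) + 6 * (card (subtree [] d) * 4 ^ k)"
    using L by linarith
qed

section \<open>Decomposability and decision gates\<close>

definition vars_from :: "nat list \<Rightarrow> nat set" where
  "vars_from t = {to_nat (z @ t, l :: nat list) | z l. True}"

text \<open>A generous upper bound for \<open>VReach\<close> that needs no range conditions.
  Variables of the parent block are absent because their values are built into \<open>s\<close>, and
  decided variables of the own block because they are built into \<open>w\<close>.\<close>

fun dgate_vars :: "dgate \<Rightarrow> nat set" where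
  "dgate_vars GTrue = {}"
| "dgate_vars (GVar v) = {v}"
| "dgate_vars (GNeg v) = {v}"
| "dgate_vars (GSub t s w) =
     {vx t j | j. length w \<le> j} \<union> {ex t i j | i j. True} \<union> (\<Union>c. vars_from (c # t))"
| "dgate_vars (GDec t s w b) =
     {vx t j | j. length w \<le> j} \<union> {ex t i j | i j. True} \<union> (\<Union>c. vars_from (c # t))"

lemma vars_fromI: "vx (z @ t) j \<in> vars_from t" "ex (z @ t) i j \<in> vars_from t"
  by (auto simp: vars_from_def vx_def ex_def)

lemma vars_from_Cons: "v \<in> vars_from (c # t) \<Longrightarrow> v \<in> vars_from t"
proof -
  assume "v \<in> vars_from (c # t)"
  then obtain z l where "v = to_nat ((z @ [c]) @ t, l :: nat list)" by (auto simp: vars_from_def)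
  then show "v \<in> vars_from t" unfolding vars_from_def by blast
qed

lemma dgate_vars_GSub_Nil: "v \<in> dgate_vars (GSub t s []) \<Longrightarrow> v \<in> vars_from t"
  using vars_fromI[of "[]" t] by (auto dest: vars_from_Cons)

lemma dgate_vars_mono: "h \<in> dgate_in d k g \<Longrightarrow> dgate_vars h \<subseteq> dgate_vars g"
proof (cases g)
  case (GSub t s w)
  assume "h \<in> dgate_in d k g"
  then consider b where "h = GDec t s w b" | "h = GTrue" | c where "h = GSub (c # t) w []"
    | i j where "h = GVar (ex t i j)"
    unfolding GSub by (auto split: if_splits)
  then show ?thesis
  proof cases
    case 3
    have "dgate_vars h \<subseteq> vars_from (c # t)" using dgate_vars_GSub_Nil by (auto simp only: 3)
    then show ?thesis unfolding GSub by auto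
  qed (auto simp: GSub)
qed (auto split: if_splits)

text \<open>The bounding sets only grow along wires, so a variable travels with every path that
  starts at its gate.\<close>

lemma VReach_tree_circuit: "VReach (tree_circuit d k) (to_nat g) \<subseteq> dgate_vars g"
proof
  fix v assume "v \<in> VReach (tree_circuit d k) (to_nat g)"
  then obtain g0 where g0: "dgate_kind k g0 = VarG v"
    "(to_nat g0, to_nat g) \<in> (wires (tree_circuit d k))\<^sup>*"
    by (auto simp: VReach_def)
  have "v \<in> dgate_vars (from_nat n)" if "(to_nat g0, n) \<in> (wires (tree_circuit d k))\<^sup>*" for n
    using that
  proof (induction rule: rtrancl_induct)
    case base
    show ?case using g0(1) by (cases g0) (auto split: if_splits)
  next
    case (step m n)
    then show ?case using dgate_vars_mono by (fastforce simp: tree_circuit_def)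
  qed
  from this[OF g0(2)] show "v \<in> dgate_vars g" by simp
qed

lemma vars_from_disjoint:
  "v \<in> vars_from (c # t) \<Longrightarrow> v \<in> vars_from (c' # t) \<Longrightarrow> c = c'"
  "vx t j \<notin> vars_from (c # t)" "ex t i j \<notin> vars_from (c # t)"
  by (auto simp: vars_from_def vx_def ex_def append_eq_append_conv2 append_eq_Cons_conv
      Cons_eq_append_conv dest: arg_cong[where f = length])

text \<open>At a complete block the inputs concern different child subtrees or single edge variables
  at \<open>t\<close>. At a \<open>GDec\<close> gate the extended prefix has removed the variable
  just decided from the remaining subproblem.\<close>

lemma decomposable_tree_circuit:
  assumes "g \<in> dgates d k" "dgate_kind k g = AndG"
  shows "decomposable (tree_circuit d k) (to_nat g)"
proof -
  have "dgate_vars x \<inter> dgate_vars y = {}"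
    if xy: "x \<in> dgate_in d k g" "y \<in> dgate_in d k g" "x \<noteq> y" for x y
  proof (cases g)
    case (GSub t s w)
    then have w: "\<not> length w < k" using assms(2) by (auto split: if_splits)
    have "z = GTrue \<or> (\<exists>c. z = GSub (c # t) w []) \<or> (\<exists>i j. z = GVar (ex t i j))"
      if "z \<in> dgate_in d k g" for z
      using that w unfolding GSub by auto
    from this[OF xy(1)] this[OF xy(2)] xy(3) show ?thesis
      by (elim disjE exE) (auto simp del: dgate_vars.simps(4) simp: vars_from_disjoint
          dest!: dgate_vars_GSub_Nil dest: vars_from_disjoint(1))
  next
    case (GDec t s w b)
    have "vx t (length w) \<notin> dgate_vars (GSub t s (w @ [b]))"
      using vars_from_disjoint by auto
    then show ?thesis using xy unfolding GDec by (auto simp del: dgate_vars.simps(4) split: if_splits)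
  qed (use assms in auto)
  then have "VReach (tree_circuit d k) (to_nat x) \<inter> VReach (tree_circuit d k) (to_nat y) = {}"
    if "x \<in> dgate_in d k g" "y \<in> dgate_in d k g" "x \<noteq> y" for x y
    using VReach_tree_circuit that by (meson disjoint_iff subsetD)
  then show ?thesis
    unfolding decomposable_def in_nbrs_tree_circuit[OF assms(1)] by blast
qed

lemma decision_gate_tree_circuit:
  assumes "g \<in> dgates d k" "dgate_kind k g = OrG"
  shows "decision_gate (tree_circuit d k) (to_nat g)"
proof -
  obtain t s w where g: "g = GSub t s w" "length w < k"
    using assms(2) by (cases g) (auto split: if_splits)
  let ?v = "vx t (length w)"
  have in_g: "GDec t s w b \<in> dgate_in d k g" for b using g by (cases b) auto
  then have dec: "GDec t s w b \<in> dgates d k" for b using assms(1) dgate_in_closed by blast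
  have neg: "GNeg ?v \<in> dgates d k"
    by (rule dgate_in_closed[OF dec[of False]]) simp
  show ?thesis
    unfolding decision_gate_def
  proof (intro exI conjI)
    show "to_nat (GDec t s w True) \<noteq> to_nat (GDec t s w False)" by simp
    show "in_nbrs (tree_circuit d k) (to_nat g) = {to_nat (GDec t s w True), to_nat (GDec t s w False)}"
      unfolding in_nbrs_tree_circuit[OF assms(1)] using g by simp
    show "gkind (tree_circuit d k) (to_nat (GDec t s w True)) = AndG"
      "gkind (tree_circuit d k) (to_nat (GDec t s w False)) = AndG" by simp_all
    show "\<exists>h\<in>in_nbrs (tree_circuit d k) (to_nat (GDec t s w True)). gkind (tree_circuit d k) h = VarG ?v"
      by (simp add: in_nbrs_tree_circuit[OF dec])
    show "\<exists>h\<in>in_nbrs (tree_circuit d k) (to_nat (GDec t s w False)). gkind (tree_circuit d k) h = NotG \<and>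
        (\<exists>l\<in>in_nbrs (tree_circuit d k) h. gkind (tree_circuit d k) l = VarG ?v)"
      by (simp add: in_nbrs_tree_circuit[OF dec] in_nbrs_tree_circuit[OF neg])
  qed
qed

lemma root_in_dgates: "GSub [] (replicate k True) [] \<in> dgates d k"
  by (auto simp: dgates_def subtree_nil)

lemma decision_dnnf_tree_circuit: "decision_dnnf (tree_circuit d k)"
proof -
  have "de_morgan_circuit (tree_circuit d k)"
    unfolding de_morgan_circuit_def
  proof (intro conjI ballI)
    show "finite (gates (tree_circuit d k))" unfolding tree_circuit_simps by (rule finite_imageI[OF dgates_size(1)])
    show "wires (tree_circuit d k) \<subseteq> gates (tree_circuit d k) \<times> gates (tree_circuit d k)"
      using dgate_in_closed by (auto simp: tree_circuit_def)
    show "acyclic (wires (tree_circuit d k))" by (rule acyclic_tree_circuit)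
    show "outgate (tree_circuit d k) \<in> gates (tree_circuit d k)"
      unfolding tree_circuit_simps by (rule imageI[OF root_in_dgates])
    fix n assume "n \<in> gates (tree_circuit d k)"
    then obtain g where g: "n = to_nat g" "g \<in> dgates d k" by auto
    show "case gkind (tree_circuit d k) n of
         VarG v \<Rightarrow> in_nbrs (tree_circuit d k) n = {}
       | ConstG b \<Rightarrow> in_nbrs (tree_circuit d k) n = {}
       | NotG \<Rightarrow> \<exists>h v. in_nbrs (tree_circuit d k) n = {h} \<and> gkind (tree_circuit d k) h = VarG v
       | AndG \<Rightarrow> in_nbrs (tree_circuit d k) n \<noteq> {}
       | OrG \<Rightarrow> in_nbrs (tree_circuit d k) n \<noteq> {}"
      unfolding g(1) in_nbrs_tree_circuit[OF g(2)] by (cases g) auto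
  qed
  then show ?thesis
    using decomposable_tree_circuit decision_gate_tree_circuit
    by (auto simp: decision_dnnf_def dnnf_def)
qed

section \<open>Equivalence of the circuit and the formula\<close>

lemma gate_true_unfold:
  "gate_true C \<alpha> n \<longleftrightarrow> (case gkind C n of
      VarG v \<Rightarrow> \<alpha> v
    | ConstG b \<Rightarrow> b
    | NotG \<Rightarrow> \<exists>h\<in>in_nbrs C n. \<exists>v. gkind C h = VarG v \<and> \<not> \<alpha> v
    | AndG \<Rightarrow> \<forall>h\<in>in_nbrs C n. gate_true C \<alpha> h
    | OrG \<Rightarrow> \<exists>h\<in>in_nbrs C n. gate_true C \<alpha> h)" (is "_ \<longleftrightarrow> ?R")
proof
  assume "gate_true C \<alpha> n"
  then show ?R by cases auto
next
  assume ?R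
  then show "gate_true C \<alpha> n"
    by (cases "gkind C n") (auto intro: gate_true.intros split: if_splits)
qed

lemma gate_true_tree_circuit:
  assumes "g \<in> dgates d k"
  shows "gate_true (tree_circuit d k) \<alpha> (to_nat g) \<longleftrightarrow> (case g of
      GTrue \<Rightarrow> True
    | GVar v \<Rightarrow> \<alpha> v
    | GNeg v \<Rightarrow> \<not> \<alpha> v
    | GSub t s w \<Rightarrow> if length w < k
        then \<exists>b. gate_true (tree_circuit d k) \<alpha> (to_nat (GDec t s w b))
        else \<forall>h\<in>dgate_in d k g. gate_true (tree_circuit d k) \<alpha> (to_nat h)
    | GDec t s w b \<Rightarrow> \<forall>h\<in>dgate_in d k g. gate_true (tree_circuit d k) \<alpha> (to_nat h))"
  unfolding gate_true_unfold[of _ _ "to_nat g"] in_nbrs_tree_circuit[OF assms]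
  by (cases g) (simp_all add: ex_bool_eq)

definition block :: "nat \<Rightarrow> (nat \<Rightarrow> bool) \<Rightarrow> nat list \<Rightarrow> bool list" where
  "block k \<alpha> t = map (\<lambda>j. \<alpha> (vx t j)) [0..<k]"

text \<open>The edge from \<open>t\<close> to its parent is left out, because a gate at
  \<open>t\<close> sees the parent block only through the stored string \<open>s\<close>.\<close>

definition below_sat :: "nat \<Rightarrow> nat \<Rightarrow> (nat \<Rightarrow> bool) \<Rightarrow> nat list \<Rightarrow> bool" where
  "below_sat d k \<alpha> t \<longleftrightarrow> (\<forall>u. u \<noteq> [] \<longrightarrow> u @ t \<in> subtree [] d \<longrightarrow> edge_sat k \<alpha> (u @ t))"

lemma below_sat_children:
  assumes "t \<in> subtree [] d"
  shows "below_sat d k \<alpha> t \<longleftrightarrow>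
    (\<forall>c<3. length t < d \<longrightarrow> edge_sat k \<alpha> (c # t) \<and> below_sat d k \<alpha> (c # t))"
proof (intro iffI allI impI conjI)
  fix c :: nat assume b: "below_sat d k \<alpha> t" and c: "c < 3" "length t < d"
  then have "[c] @ t \<in> subtree [] d" using assms by (auto simp: subtree_nil)
  then show "edge_sat k \<alpha> (c # t)" using b unfolding below_sat_def by (metis append_Cons append_Nil list.distinct(1))
  show "below_sat d k \<alpha> (c # t)"
    unfolding below_sat_def
  proof (intro allI impI)
    fix u assume "u @ c # t \<in> subtree [] d"
    then show "edge_sat k \<alpha> (u @ c # t)"
      using b[unfolded below_sat_def, rule_format, of "u @ [c]"] by simp
  qed
next
  assume R: "\<forall>c<3. length t < d \<longrightarrow> edge_sat k \<alpha> (c # t) \<and> below_sat d k \<alpha> (c # t)"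
  show "below_sat d k \<alpha> t"
    unfolding below_sat_def
  proof (intro allI impI)
    fix u assume u: "u \<noteq> []" "u @ t \<in> subtree [] d"
    then obtain z c where z: "u = z @ [c]" by (metis rev_exhaust)
    then have "c < 3" "length t < d" using u by (auto simp: subtree_nil)
    then show "edge_sat k \<alpha> (u @ t)"
      using R u z by (cases "z = []") (auto simp: below_sat_def)
  qed
qed

text \<open>The prefix \<open>w\<close> has to agree with \<alpha>, as only the decision branches
  that follow \<alpha> can be true; \<open>s\<close> may be any string of length \<open>k\<close>,
  which lets the induction on the rank pass from a node to its children.\<close>

lemma gate_true_GSub:
  assumes "t \<in> subtree [] d" "length s = k" "length w \<le> k" "w = take (length w) (block k \<alpha> t)"
  shows "gate_true (tree_circuit d k) \<alpha> (to_nat (GSub t s w)) \<longleftrightarrow>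
    (t \<noteq> [] \<longrightarrow> (\<forall>i<k. \<forall>j<k. s ! i \<or> \<alpha> (ex t i j) \<or> \<alpha> (vx t j))) \<and> below_sat d k \<alpha> t"
  using assms
proof (induction "dgate_rank d k (GSub t s w)" arbitrary: t s w rule: less_induct)
  case less
  let ?T = "\<lambda>g. gate_true (tree_circuit d k) \<alpha> (to_nat g)"
  have g: "GSub t s w \<in> dgates d k" using less.prems(1-3) by simp
  have len: "length (block k \<alpha> u) = k" for u by (simp add: block_def)
  show ?case (is "_ \<longleftrightarrow> ?R")
  proof (cases "length w < k")
    case True
    let ?v = "vx t (length w)"
    have dec: "GDec t s w b \<in> dgates d k" for b
      using less.prems(1,2) True by simp
    have lit: "GVar ?v \<in> dgates d k" "GNeg ?v \<in> dgates d k"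
      using less.prems(1) True by simp_all
    \<comment> \<open>The literal in the branch kills the choice of \<open>b\<close> that disagrees
      with \<alpha>, so the disjunction equals the subproblem with the prefix extended by the actual
      value.\<close>
    have T: "?T (GDec t s w b) \<longleftrightarrow> \<alpha> ?v = b \<and> ?T (GSub t s (w @ [b]))" for b
      using gate_true_tree_circuit[OF dec, of \<alpha> b] gate_true_tree_circuit[OF lit(1), of \<alpha>]
        gate_true_tree_circuit[OF lit(2), of \<alpha>] by (cases b) simp_all
    have eq: "w @ [\<alpha> ?v] = take (length (w @ [\<alpha> ?v])) (block k \<alpha> t)"
      using True less.prems(4) len[of t] by (simp add: take_Suc_conv_app_nth) (simp add: block_def)
    have "?T (GSub t s (w @ [\<alpha> ?v])) \<longleftrightarrow> ?R"
      by (rule less.hyps[OF _ less.prems(1,2) _ eq]) (use True in simp_all)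
    then show ?thesis
      using gate_true_tree_circuit[OF g, of \<alpha>] True T by simp
  next
    case False
    then have w1: "length w = k" using less.prems(3) by linarith
    moreover have "w = block k \<alpha> t" using less.prems(4) w1 len[of t] by (metis order_refl take_all)
    ultimately have w: "length w = k" "w = block k \<alpha> t" by blast+
    have nth: "block k \<alpha> t ! i = \<alpha> (vx t i)" if "i < k" for i using that by (simp add: block_def)
    have "?T (GSub (c # t) w []) \<longleftrightarrow> edge_sat k \<alpha> (c # t) \<and> below_sat d k \<alpha> (c # t)"
      if c: "c < 3" "length t < d" for c
    proof -
      have "GSub (c # t) w [] \<in> dgate_in d k (GSub t s w)" using c False by auto
      \<comment> \<open>For a child the stored parent string \<open>w\<close> is the actual block of
        \<open>t\<close>, so the condition with a fixed string becomes
        \<open>edge_sat\<close>.\<close>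
      from dgate_rank_less[OF g this] have "?T (GSub (c # t) w []) \<longleftrightarrow>
        (c # t \<noteq> [] \<longrightarrow> (\<forall>i<k. \<forall>j<k. w ! i \<or> \<alpha> (ex (c # t) i j) \<or> \<alpha> (vx (c # t) j))) \<and>
        below_sat d k \<alpha> (c # t)"
        using less.prems(1) c w(1) by (intro less.hyps) (auto simp: subtree_nil)
      then show ?thesis by (simp add: edge_sat_def w(2) nth)
    qed
    moreover have "?T (GVar (ex t i j)) \<longleftrightarrow> \<alpha> (ex t i j)" if "i < k" "j < k" "t \<noteq> []" for i j
    proof -
      have "GVar (ex t i j) \<in> dgates d k"
        using that less.prems(1) by simp
      from gate_true_tree_circuit[OF this, of \<alpha>] show ?thesis by simp
    qed
    moreover have "?T GTrue"
      using gate_true_tree_circuit[of GTrue d k \<alpha>] by simp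
    moreover have "?T (GSub t s w) \<longleftrightarrow> ?T GTrue \<and>
      (\<forall>c<3. length t < d \<longrightarrow> ?T (GSub (c # t) w [])) \<and>
      (\<forall>i<k. \<forall>j<k. t \<noteq> [] \<longrightarrow> \<not> s ! i \<longrightarrow> \<not> w ! j \<longrightarrow> ?T (GVar (ex t i j)))"
      unfolding gate_true_tree_circuit[OF g, of \<alpha>] using False by (simp add: ball_Un) blast
    ultimately show ?thesis
      unfolding below_sat_children[OF less.prems(1)] using nth w(2) by (metis (no_types, lifting))
  qed
qed

text \<open>The root has no parent edge, so its block occurs only in the clauses of its children;
  this is where \<open>d \<ge> 1\<close> enters, through the child \<open>[0]\<close>.\<close>

lemma cnf_vars_tree_cnf:
  assumes "d \<ge> 1" "k \<ge> 1"
  shows "cnf_vars (tree_cnf d k) = tree_vars d k"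
proof
  have vars: "cnf_vars (tree_cnf d k) = (\<Union>(y, i, j) \<in> (subtree [] d - {[]}) \<times> {..<k} \<times> {..<k}.
      {vx (tl y) i, ex y i j, vx y j})"
    by (simp add: cnf_vars_def tree_cnf_def image_Union image_image case_prod_unfold)
  have "tl y \<in> subtree [] d" if "y \<in> subtree [] d" for y
    using that by (cases y) (auto simp: subtree_nil)
  then show "cnf_vars (tree_cnf d k) \<subseteq> tree_vars d k"
    unfolding vars by (intro UN_least) (auto split: prod.splits)
  show "tree_vars d k \<subseteq> cnf_vars (tree_cnf d k)"
  proof
    fix v assume "v \<in> tree_vars d k"
    then have "(\<exists>t\<in>subtree [] d. \<exists>j<k. v = vx t j) \<or>
        (\<exists>y\<in>subtree [] d - {[]}. \<exists>i<k. \<exists>j<k. v = ex y i j)"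
      unfolding tree_vars_def by fastforce
    then consider t j where "v = vx t j" "t \<in> subtree [] d" "j < k"
      | y i j where "v = ex y i j" "y \<in> subtree [] d - {[]}" "i < k" "j < k"
      by metis
    then obtain y i j where "y \<in> subtree [] d - {[]}" "i < k" "j < k"
      "v \<in> {vx (tl y) i, ex y i j, vx y j}"
    proof cases
      case (1 t j)
      show ?thesis
      proof (cases "t = []")
        case True
        then show ?thesis using that[of "[0]" j j] 1 assms by (auto simp: subtree_nil)
      next
        case False
        then show ?thesis using that[of t j j] 1 by auto
      qed
    next
      case (2 y i j)
      then show ?thesis using that[of y i j] by auto
    qed
    then show "v \<in> cnf_vars (tree_cnf d k)"
      unfolding vars by (intro UN_I[of "(y, i, j)"]) simp_all
  qed
qed

lemma circuit_equiv_cnf_tree: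
  assumes "d \<ge> 1" "k \<ge> 1"
  shows "circuit_equiv_cnf (tree_circuit d k) (tree_cnf d k)"
proof -
  have "circuit_vars (tree_circuit d k) \<subseteq> tree_vars d k"
    by (auto simp: circuit_vars_def dgates_def split: if_splits)
  moreover have "circuit_sat \<alpha> (tree_circuit d k) \<longleftrightarrow> cnf_sat \<alpha> (tree_cnf d k)" for \<alpha>
    \<comment> \<open>At the root only the length of the stored string matters, and the empty prefix
      agrees with every \<alpha>.\<close>
    using gate_true_GSub[of "[]" d "replicate k True" k "[]" \<alpha>]
    by (auto simp: circuit_sat_def cnf_sat_tree_cnf below_sat_def subtree_nil)
  ultimately show ?thesis
    unfolding circuit_equiv_cnf_def cnf_vars_tree_cnf[OF assms] by blast
qed

section \<open>Size estimates\<close>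

lemma card_subtree_nil: "3 ^ d \<le> card (subtree [] d)" "card (subtree [] d) \<le> 3 * 3 ^ d"
proof -
  have eq: "card (subtree [] d) = (\<Sum>i\<le>d. 3 ^ i)"
    unfolding subtree_nil using card_lists_length_le[of "{..<3::nat}" d] by simp
  show "3 ^ d \<le> card (subtree [] d)" unfolding eq by (cases d) simp_all
  have "(\<Sum>i\<le>d. 3 ^ i) \<le> (3 * 3 ^ d :: nat)" by (induction d) simp_all
  then show "card (subtree [] d) \<le> 3 * 3 ^ d" unfolding eq .
qed

lemma card_tree_vars:
  "card (subtree [] d) * k \<le> card (tree_vars d k)"
  "card (tree_vars d k) \<le> card (subtree [] d) * (k + k * k)"
proof -
  let ?V = "(\<lambda>(t, j). vx t j) ` (subtree [] d \<times> {..<k})"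
  let ?E = "(\<lambda>(y, i, j). ex y i j) ` ((subtree [] d - {[]}) \<times> {..<k} \<times> {..<k})"
  have "inj_on (\<lambda>(t, j). vx t j) (subtree [] d \<times> {..<k})" by (auto simp: inj_on_def)
  then have V: "card ?V = card (subtree [] d) * k" by (simp add: card_image card_cartesian_product)
  show "card (subtree [] d) * k \<le> card (tree_vars d k)"
    unfolding V[symmetric] by (rule card_mono[OF finite_tree_vars]) (simp add: tree_vars_def)
  have "card ?E \<le> card ((subtree [] d - {[]}) \<times> {..<k} \<times> {..<k})"
    by (rule card_image_le) (simp add: finite_subtree)
  also have "\<dots> \<le> card (subtree [] d) * (k * k)"
    unfolding card_cartesian_product card_lessThan
    by (intro mult_right_mono card_mono finite_subtree) auto
  finally have "card ?E \<le> card (subtree [] d) * (k * k)" .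
  then show "card (tree_vars d k) \<le> card (subtree [] d) * (k + k * k)"
    unfolding tree_vars_def using card_Un_le[of ?V ?E] V by (simp add: distrib_left)
qed

text \<open>The variable number is exponential in \<open>r\<close> from both sides: the lower bounds
  serve the circuit size, the upper bound turns \<open>r\<close> into a multiple of the logarithm
  for branching programs.\<close>

lemma num_vars_bounds:
  assumes "r \<ge> 1"
  shows "card (subtree [] r) \<le> num_vars (tree_cnf r (2 * r))" "3 ^ r \<le> num_vars (tree_cnf r (2 * r))"
    "num_vars (tree_cnf r (2 * r)) \<le> 2 ^ (9 * r)"
proof -
  let ?n = "num_vars (tree_cnf r (2 * r))" and ?T = "card (subtree [] r)"
  have n: "?n = card (tree_vars r (2 * r))"
    using assms by (simp add: num_vars_def cnf_vars_tree_cnf)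
  have "?T * 1 \<le> ?T * (2 * r)" using assms by (intro mult_le_mono) auto
  then show T: "?T \<le> ?n" using card_tree_vars(1)[of r "2 * r"] unfolding n by linarith
  then show "3 ^ r \<le> ?n" using card_subtree_nil(1)[of r] by linarith
  have r: "r \<le> 2 ^ r" by (simp add: less_imp_le)
  have "r * r \<le> 2 ^ r * 2 ^ r" using r by (intro mult_le_mono) auto
  also have "2 ^ r * 2 ^ r = (4 ^ r :: nat)" by (simp flip: power_mult_distrib)
  finally have rr: "r * r \<le> 4 ^ r" .
  have "r \<le> r * r" using assms by simp
  moreover have "2 * r * (2 * r) = 4 * (r * r)" by simp
  ultimately have k: "2 * r + 2 * r * (2 * r) \<le> 6 * 4 ^ r" using rr by linarith
  have "?n \<le> ?T * (2 * r + 2 * r * (2 * r))" unfolding n by (rule card_tree_vars(2))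
  also have "\<dots> \<le> 3 * 3 ^ r * (6 * 4 ^ r)" by (intro mult_le_mono card_subtree_nil k)
  also have "\<dots> = 18 * 12 ^ r" by (simp flip: power_mult_distrib)
  \<comment> \<open>Rounding 18 and 12 up to powers of two gives the exponent
    \<open>5 + 4 * r\<close>, at most \<open>9 * r\<close> for \<open>r \<ge> 1\<close>.\<close>
  also have "\<dots> \<le> 2 ^ 5 * 16 ^ r" by (intro mult_le_mono power_mono) auto
  also have "\<dots> \<le> 2 ^ (5 * r) * 16 ^ r" using assms by (intro mult_right_mono power_increasing) auto
  also have "\<dots> = 2 ^ (9 * r)" by (simp add: power_mult flip: power_mult_distrib)
  finally show "?n \<le> 2 ^ (9 * r)" .
qed

lemma tree_circuit_size:
  assumes "r \<ge> 1"
  shows "circuit_size (tree_circuit r (2 * r)) \<le> 9 * num_vars (tree_cnf r (2 * r)) ^ 5"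
proof -
  let ?n = "num_vars (tree_cnf r (2 * r))"
  have n: "card (tree_vars r (2 * r)) = ?n"
    using assms by (simp add: num_vars_def cnf_vars_tree_cnf)
  have pos: "1 \<le> ?n" using num_vars_bounds(2)[OF assms] by (meson le_trans one_le_numeral one_le_power)
  \<comment> \<open>The two strings of \<open>2 * r\<close> bits cost at most the fourth power of
    \<open>3 ^ r\<close>, and the tree node itself one more factor; this yields the exponent
    5.\<close>
  have "(4 :: nat) ^ (2 * r) = 16 ^ r" by (simp add: power_mult)
  also have "\<dots> \<le> 81 ^ r" by (rule power_mono) auto
  also have "\<dots> = (3 ^ r) ^ 4" by (simp flip: power_mult add: mult.commute[of r], simp add: power_mult)
  also have "\<dots> \<le> ?n ^ 4" by (intro power_mono num_vars_bounds(2)[OF assms]) simp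
  finally have "card (subtree [] r) * 4 ^ (2 * r) \<le> ?n * ?n ^ 4"
    using num_vars_bounds(1)[OF assms] by (rule mult_le_mono[rotated])
  then have "card (subtree [] r) * 4 ^ (2 * r) \<le> ?n ^ 5" by (simp add: numeral_eq_Suc)
  moreover have "?n ^ 1 \<le> ?n ^ 5" "1 \<le> ?n ^ 5" using pos by (intro power_increasing, auto)
  moreover have "circuit_size (tree_circuit r (2 * r)) \<le> card (dgates r (2 * r))"
    unfolding circuit_size_def tree_circuit_simps by (rule card_image_le[OF dgates_size(1)])
  ultimately show ?thesis using dgates_size(2)[of r "2 * r"] unfolding n by simp
qed

lemma tree_cnf_robp_lower_bound:
  assumes r: "r \<ge> 1" and B: "robp B" "robp_computes B (tree_cnf r (2 * r))"
  shows "real (num_vars (tree_cnf r (2 * r))) powr (log 2 (real (num_vars (tree_cnf r (2 * r)))) / 486)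
    \<le> real (robp_size B)"
proof -
  let ?n = "real (num_vars (tree_cnf r (2 * r)))" and ?N = "real (robp_size B)"
  have "1 \<le> num_vars (tree_cnf r (2 * r))"
    using num_vars_bounds(2)[OF r] by (meson le_trans one_le_numeral one_le_power)
  then have n1: "1 \<le> ?n" by simp
  have "?n \<le> 2 ^ (9 * r)" using num_vars_bounds(3)[OF r] by (metis of_nat_le_iff of_nat_numeral of_nat_power)
  then have "log 2 ?n \<le> log 2 (2 ^ (9 * r))" using n1 by (subst log_le_cancel_iff) auto
  then have log: "log 2 ?n \<le> 9 * real r" by (simp add: log_nat_power)
  have log0: "0 \<le> log 2 ?n" using n1 by simp
  have "?n powr (log 2 ?n / 486) = (2 powr log 2 ?n) powr (log 2 ?n / 486)" using n1 by simp
  also have "\<dots> = 2 powr (log 2 ?n * log 2 ?n / 486)" by (simp only: powr_powr times_divide_eq_right)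
  \<comment> \<open>Here \<open>log 2 ?n \<le> 9 * r\<close>, and 486 is 81 times 6, leaving the
    exponent \<open>r * r / 6\<close>.\<close>
  also have "\<dots> \<le> 2 powr ((9 * real r) * (9 * real r) / 486)"
    by (intro powr_mono divide_right_mono mult_mono log log0) auto
  also have "\<dots> = 2 powr (real (r * r) / 6)" by simp
  also have "\<dots> \<le> ?N"
  \<comment> \<open>Sixth powers are compared: cubing \<open>(4/3)^(r * r) \<le> ?N ^ 2\<close> and
    using that the cube of 4/3 exceeds 2 gives \<open>2 ^ (r * r) \<le> ?N ^ 6\<close>.\<close>
  proof (rule power_le_imp_le_base)
    have "real (4 ^ (r * r)) \<le> real (robp_size B ^ 2 * 3 ^ (r * r))"
      unfolding of_nat_le_iff using tree_cnf_robp_size[OF B] r by simp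
    then have "(4 / 3) ^ (r * r) \<le> ?N ^ 2" by (simp add: power_divide field_simps)
    then have "((4 / 3) ^ (r * r)) ^ 3 \<le> (?N ^ 2) ^ 3" by (intro power_mono) auto
    moreover have "(2 :: real) ^ (r * r) \<le> ((4 / 3) ^ 3) ^ (r * r)" by (intro power_mono) (auto simp: power3_eq_cube)
    moreover have "(((4 / 3) :: real) ^ 3) ^ (r * r) = ((4 / 3) ^ (r * r)) ^ 3"
      by (simp only: mult.commute flip: power_mult)
    moreover have "(?N ^ 2) ^ 3 = ?N ^ Suc 5" by (simp flip: power_mult)
    ultimately have "2 ^ (r * r) \<le> ?N ^ Suc 5" by linarith
    moreover have "(2 powr (real (r * r) / 6)) ^ Suc 5 = 2 ^ (r * r)"
      by (simp add: powr_power powr_realpow flip: of_nat_mult)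
    ultimately show "(2 powr (real (r * r) / 6)) ^ Suc 5 \<le> ?N ^ Suc 5" by simp
  qed simp
  finally show ?thesis .
qed

theorem theorem5:
  "\<exists>c::real. c > 0 \<and> (\<exists>\<Phi> :: cnf set.
     (\<forall>F\<in>\<Phi>. is_cnf F) \<and> infinite (num_vars ` \<Phi>) \<and>
     (\<exists>K::real. K > 0 \<and>
        (\<forall>F\<in>\<Phi>. \<exists>D. decision_dnnf D \<and> circuit_equiv_cnf D F \<and>
           real (circuit_size D) \<le> K * real (num_vars F) ^ 5)) \<and>
     (\<exists>\<delta>::real. \<delta> > 0 \<and>
        (\<forall>F\<in>\<Phi>. \<forall>B. robp B \<and> robp_computes B F \<longrightarrow>
           real (robp_size B) \<ge> \<delta> * real (num_vars F) powr (log 2 (real (num_vars F)) / c))))"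
proof -
  \<comment> \<open>Height \<open>r\<close> and blocks of \<open>2 * r\<close> vertices give cuts
    with \<open>r * r\<close> disjoint edges, while the strings stored in a gate still have length
    linear in \<open>r\<close>.\<close>
  let ?\<Phi> = "(\<lambda>r. tree_cnf r (2 * r)) ` {1..}"
  have "infinite (num_vars ` ?\<Phi>)"
    unfolding finite_nat_set_iff_bounded_le
  proof
    assume "\<exists>m. \<forall>n\<in>num_vars ` ?\<Phi>. n \<le> m"
    then obtain m where m: "\<And>r. r \<ge> 1 \<Longrightarrow> num_vars (tree_cnf r (2 * r)) \<le> m" by auto
    have "m < 3 ^ Suc m" by (induction m) simp_all
    also have "\<dots> \<le> num_vars (tree_cnf (Suc m) (2 * Suc m))" by (rule num_vars_bounds(2)) simp
    also have "\<dots> \<le> m" by (rule m) simp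
    finally show False by simp
  qed
  moreover have "\<exists>D. decision_dnnf D \<and> circuit_equiv_cnf D F \<and>
      real (circuit_size D) \<le> 9 * real (num_vars F) ^ 5" if F: "F \<in> ?\<Phi>" for F
  proof -
    obtain r where r: "r \<ge> 1" "F = tree_cnf r (2 * r)" using F by auto
    have "real (circuit_size (tree_circuit r (2 * r))) \<le> real (9 * num_vars F ^ 5)"
      unfolding of_nat_le_iff r(2) by (rule tree_circuit_size[OF r(1)])
    then have "real (circuit_size (tree_circuit r (2 * r))) \<le> 9 * real (num_vars F) ^ 5" by simp
    then show ?thesis
      using decision_dnnf_tree_circuit circuit_equiv_cnf_tree[of r "2 * r"] r by auto
  qed
  moreover have "1 * real (num_vars F) powr (log 2 (real (num_vars F)) / 486) \<le> real (robp_size B)"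
    if "F \<in> ?\<Phi>" "robp B \<and> robp_computes B F" for F B
    using tree_cnf_robp_lower_bound that by auto
  moreover have "\<forall>F\<in>?\<Phi>. is_cnf F" by (simp add: is_cnf_tree_cnf)
  ultimately show ?thesis
    by (intro exI[of _ 486] exI[of _ ?\<Phi>] conjI exI[of _ 9] exI[of _ 1]) auto
qed

end
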